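(* The set of positive integers $m$ such that $d(m)=f(m)$ has asymptotic density $1$.
   Context: For a positive integer $m$, let $\varphi(m)$ be Euler's function and $\lambda(m)$ the Carmichael function (the exponent of the multiplicative group $(\mathbb{Z}/m\mathbb{Z})^*$). Let $\mathrm{rad}(m)$ be the product of the distinct primes dividing $m$. Let $\delta=2$ if $4\mid m$ and $\delta=1$ otherwise. Define $$ d(m)=\gcd\big(m,\ \delta\,\varphi(\mathrm{rad}(m))\big),\qquad f(m)=\gcd\big(m,\ \delta\,\lambda(m)\varphi(\mathrm{rad}(m))/\varphi(m)\big). $$ *)

theory Defs
  imports "HOL-Analysis.Analysis" "HOL-Number_Theory.Number_Theory"
begin

definition rad :: "nat \<Rightarrow> nat" where
  "rad m = (\<Prod>p\<in>prime_factors m. p)"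

definition delta :: "nat \<Rightarrow> nat" where
  "delta m = (if 4 dvd m then 2 else 1)"

definition d_fun :: "nat \<Rightarrow> nat" where
  "d_fun m = gcd m (delta m * totient (rad m))"

text \<open>The quotient delta*lambda*phi(rad m)/phi(m) is an integer; nat division is exact here.\<close>
definition f_fun :: "nat \<Rightarrow> nat" where
  "f_fun m = gcd m (delta m * Carmichael m * totient (rad m) div totient m)"

end

theory Submission
  imports Defs "HOL-Complex_Analysis.Complex_Analysis"
begin

text \<open>
  For \<open>p\<close> exactly dividing \<open>m\<close> the \<open>p\<close>-parts of \<open>d(m)\<close> and \<open>f(m)\<close> always agree.  If \<open>p\<^sup>2\<close> divides \<open>m\<close>,
  they agree as soon as \<open>m\<close> has a prime factor \<open>q \<equiv> 1\<close> modulo \<open>p\<close> to the power \<open>2 v\<^sub>p(m)\<close>: then \<open>q - 1\<close>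
  divides both \<open>\<phi>(rad m)\<close> and \<open>\<lambda>(m)\<close>, so both \<open>p\<close>-parts equal that of \<open>m\<close>.  Integers divisible by a large
  square or by a high power of a small prime have small density, and for a fixed modulus \<open>n\<close> almost
  every integer has a prime factor \<open>q \<equiv> 1 (mod n)\<close>, since \<open>\<Sum> 1/q\<close> diverges over these primes.

  The divergence is obtained by Landau's method, for all characters at once and without proving
  \<open>L(1,\<chi>) \<noteq> 0\<close>.  Let \<open>F(s) = \<Prod>\<^sub>\<chi> L(s,\<chi>)\<close>, where each \<open>(s - 1) L(s,\<chi>)\<close> is holomorphic for \<open>Re s > 0\<close>.  If
  \<open>\<Sum> 1/q\<close> converged, \<open>F\<close> would be bounded on \<open>(1,2]\<close> and hence holomorphic for \<open>Re s > 0\<close>.  By orthogonality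
  the Euler factors of \<open>F\<close> are power series in \<open>q\<^sup>-\<^sup>s\<close> with nonnegative coefficients, so the Taylor series
  of \<open>F\<close> at \<open>2\<close> dominates that of each finite partial product of the \<open>1 + c q\<^sup>-\<^sup>t\<^sup>s\<close>, \<open>t = \<phi>(n)\<close>, on all of \<open>(0,2)\<close>.
  At \<open>s = 1/t\<close> this bounds \<open>\<Sum> 1/q\<close> over all primes, which diverges by the case \<open>n = 1\<close>.
\<close>

section \<open>Characters modulo a prime power\<close>

text \<open>Dirichlet characters modulo \<open>n\<close>, as functions on all of \<open>nat\<close>.
  Fixing the zeros exactly makes each one determined by its values on units.\<close>

definition dchars :: "nat \<Rightarrow> (nat \<Rightarrow> complex) set" where
  "dchars n = {\<xi>. \<xi> 1 = 1 \<and> (\<forall>a b. \<xi> (a * b) = \<xi> a * \<xi> b) \<and>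
     (\<forall>a b. [a = b] (mod n) \<longrightarrow> \<xi> a = \<xi> b) \<and> (\<forall>a. \<xi> a = 0 \<longleftrightarrow> \<not> coprime a n)}"

lemma dchars_1: "\<xi> \<in> dchars n \<Longrightarrow> \<xi> 1 = 1"
  and dchars_mult: "\<xi> \<in> dchars n \<Longrightarrow> \<xi> (a * b) = \<xi> a * \<xi> b"
  and dchars_cong: "\<xi> \<in> dchars n \<Longrightarrow> [a = b] (mod n) \<Longrightarrow> \<xi> a = \<xi> b"
  and dchars_eq_0_iff: "\<xi> \<in> dchars n \<Longrightarrow> \<xi> a = 0 \<longleftrightarrow> \<not> coprime a n"
  by (auto simp: dchars_def)

lemma dchars_power: "\<xi> \<in> dchars n \<Longrightarrow> \<xi> (a ^ k) = \<xi> a ^ k"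
  using dchars_1[of \<xi> n] by (induction k) (auto simp: dchars_mult)

lemma dchars_power_totient:
  assumes "\<xi> \<in> dchars n" "coprime a n"
  shows "\<xi> a ^ totient n = 1"
proof -
  have "\<xi> (a ^ totient n) = \<xi> 1"
    by (intro dchars_cong[OF assms(1)] euler_theorem assms)
  thus ?thesis using assms by (simp add: dchars_power dchars_1[OF assms(1), simplified])
qed

lemma norm_dchars:
  assumes "\<xi> \<in> dchars n" "coprime a n" "n > 0"
  shows "norm (\<xi> a) = 1"
proof -
  have "norm (\<xi> a) ^ totient n = 1"
    using dchars_power_totient[OF assms(1,2)] by (metis norm_one norm_power)
  thus ?thesis 
    using assms(3) power_eq_imp_eq_base[of "norm (\<xi> a)" "totient n" 1] by simp
qed

lemma norm_dchars_le_1: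
  assumes "\<xi> \<in> dchars n" "n > 0"
  shows "norm (\<xi> a) \<le> 1"
  using norm_dchars[OF assms(1) _ assms(2), of a] dchars_eq_0_iff[OF assms(1), of a]
  by (cases "coprime a n") auto

text \<open>By periodicity a character is determined by its values on \<open>{..<n}\<close>, and
  these lie in the finite set consisting of 0 and the roots of unity of order dividing
  \<open>totient n\<close>.\<close>

lemma finite_dchars:
  assumes "n > 0"
  shows "finite (dchars n)"
proof -
  define V where "V = insert 0 {z::complex. z ^ totient n = 1}"
  have "finite V"
    using finite_roots_unity[of "totient n"] totient_gt_0_iff[of n] assms by (simp add: V_def Suc_le_eq)
  have "inj_on (\<lambda>\<xi>. restrict \<xi> {..<n}) (dchars n)"
  proof (rule inj_onI)
    fix \<xi> \<psi> assume *: "\<xi> \<in> dchars n" "\<psi> \<in> dchars n" "restrict \<xi> {..<n} = restrict \<psi> {..<n}"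
    show "\<xi> = \<psi>"
    proof
      fix a
      have "\<xi> a = \<xi> (a mod n)" "\<psi> a = \<psi> (a mod n)"
        using dchars_cong[OF *(1), of a "a mod n"] dchars_cong[OF *(2), of a "a mod n"]
        by (auto simp: cong_def)
      moreover have "\<xi> (a mod n) = \<psi> (a mod n)"
        using fun_cong[OF *(3), of "a mod n"] assms by simp
      ultimately show "\<xi> a = \<psi> a" by simp
    qed
  qed
  moreover have "(\<lambda>\<xi>. restrict \<xi> {..<n}) ` dchars n \<subseteq> {..<n} \<rightarrow>\<^sub>E V"
  proof (rule image_subsetI)
    fix \<xi> assume \<xi>: "\<xi> \<in> dchars n"
    have "\<xi> a \<in> V" for a
      using dchars_power_totient[OF \<xi>, of a] dchars_eq_0_iff[OF \<xi>, of a] by (auto simp: V_def)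
    thus "restrict \<xi> {..<n} \<in> {..<n} \<rightarrow>\<^sub>E V" by auto
  qed
  ultimately show ?thesis
    using \<open>finite V\<close> by (meson finite_PiE finite_imageD finite_lessThan finite_subset)
qed

text \<open>The principal character serves to show that \<open>dchars n\<close> is nonempty.\<close>

lemma dchars_principal: "(\<lambda>a. if coprime a n then 1 else 0) \<in> dchars n"
proof -
  have "coprime a n = coprime b n" if "[a = b] (mod n)" for a b
    using cong_imp_coprime[OF that] cong_imp_coprime[OF cong_sym[OF that]] by blast
  thus ?thesis unfolding dchars_def mem_Collect_eq by simp
qed

lemma dchars_times: "\<xi> \<in> dchars n \<Longrightarrow> \<psi> \<in> dchars n \<Longrightarrow> (\<lambda>a. \<xi> a * \<psi> a) \<in> dchars n"
proof -
  assume *: "\<xi> \<in> dchars n" "\<psi> \<in> dchars n"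
  have "\<xi> a * \<psi> a = \<xi> b * \<psi> b" if "[a = b] (mod n)" for a b
    using dchars_cong[OF *(1) that] dchars_cong[OF *(2) that] by simp
  thus ?thesis using dchars_1[OF *(1)] dchars_1[OF *(2)] *
    by (subst dchars_def) (auto simp: dchars_mult dchars_eq_0_iff)
qed

section \<open>Orthogonality of characters\<close>

lemma sum_dchars_eq_card:
  assumes "[a = 1] (mod n)"
  shows "(\<Sum>\<xi>\<in>dchars n. \<xi> a) = of_nat (card (dchars n))"
proof -
  have "\<xi> a = 1" if "\<xi> \<in> dchars n" for \<xi>
    using dchars_cong[OF that assms] dchars_1[OF that] by simp
  hence "(\<Sum>\<xi>\<in>dchars n. \<xi> a) = (\<Sum>\<xi>\<in>dchars n. 1)" by (intro sum.cong) auto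
  thus ?thesis by simp
qed

text \<open>Multiplication by \<psi> permutes the finite set of characters, so the sum is unchanged
  when multiplied by \<open>\<psi> a\<close>, which is not 1.\<close>

lemma sum_dchars_eq_0:
  assumes "n > 0" "\<psi> \<in> dchars n" "\<psi> a \<noteq> 1"
  shows "(\<Sum>\<xi>\<in>dchars n. \<xi> a) = 0"
proof (cases "coprime a n")
  case False
  thus ?thesis by (intro sum.neutral) (auto simp: dchars_eq_0_iff)
next
  case True
  define T where "T = (\<lambda>\<xi> (a::nat). \<psi> a * \<xi> a)"
  have inj: "inj_on T (dchars n)"
  proof (rule inj_onI, rule ext)
    fix \<xi> \<xi>' b assume *: "\<xi> \<in> dchars n" "\<xi>' \<in> dchars n" "T \<xi> = T \<xi>'"
    show "\<xi> b = \<xi>' b"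
    proof (cases "coprime b n")
      case True
      thus ?thesis using fun_cong[OF *(3), of b] dchars_eq_0_iff[OF assms(2)] by (auto simp: T_def)
    next
      case False
      thus ?thesis using dchars_eq_0_iff[OF *(1), of b] dchars_eq_0_iff[OF *(2), of b] by simp
    qed
  qed
  have "T ` dchars n \<subseteq> dchars n"
    using dchars_times[OF assms(2)] by (auto simp: T_def)
  hence im: "T ` dchars n = dchars n"
    using inj finite_dchars[OF assms(1)] by (simp add: card_image card_subset_eq)
  have "(\<Sum>\<xi>\<in>dchars n. \<xi> a) = (\<Sum>\<xi>\<in>T ` dchars n. \<xi> a)"
    by (simp add: im)
  also have "\<dots> = \<psi> a * (\<Sum>\<xi>\<in>dchars n. \<xi> a)"
    by (subst sum.reindex[OF inj]) (simp add: T_def sum_distrib_left)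
  finally show ?thesis using assms(3) by (simp add: mult_cancel_right1)
qed

text \<open>Every unit is \<open>g ^ i\<close> or \<open>g ^ i * w\<close>, and the exponent is unique modulo \<open>ord n g\<close>;
  the pairs \<open>(g, 1)\<close> for odd prime powers and \<open>(5, -1)\<close> for powers of two are of this kind.\<close>
lemma dchars_exist_index:
  fixes n g w :: nat
  assumes n: "n > 0" and g: "coprime g n" and w: "[w * w = 1] (mod n)"
    and gw: "\<And>i. [g ^ i = w] (mod n) \<Longrightarrow> ord n g dvd i"
    and gen: "\<And>x. coprime x n \<Longrightarrow> \<exists>i. [x = g ^ i] (mod n) \<or> [x = g ^ i * w] (mod n)"
    and a: "coprime a n" "\<not> [a = 1] (mod n)" "\<not> [a = w] (mod n)"
  shows "\<exists>\<psi>\<in>dchars n. \<psi> a \<noteq> 1"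
proof -
  define m where "m = ord n g"
  have m: "m > 0" using g by (simp add: m_def coprime_commute)
  define R where "R = (\<lambda>x i. [x = g ^ i] (mod n) \<or> [x = g ^ i * w] (mod n))"
  have RE: "\<exists>e. [x = g ^ i * w ^ e] (mod n)" if "R x i" for x i
    using that unfolding R_def by (metis mult.right_neutral power_0 power_one_right)
  have wpow: "[w ^ e = (if even e then 1 else w)] (mod n)" for e
  proof (induction e)
    case (Suc e)
    from cong_mult[OF cong_refl[of w n] Suc] show ?case
      using w by (auto simp: cong_def split: if_splits)
  qed auto
  have RI: "R x i" if "[x = g ^ i * w ^ e] (mod n)" for x i e
    using cong_trans[OF that cong_mult[OF cong_refl[of "g ^ i"] wpow[of e]]]
    by (auto simp: R_def split: if_splits)
  \<comment> \<open>The factor \<open>w ^ e * g ^ ((m-1) * j)\<close> acts as the inverse of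
    \<open>w ^ e * g ^ j\<close>. After multiplication by it, \<open>g\<close> to the power i - j is
    congruent to 1 or to \<open>w\<close>, and in both cases \<open>m\<close> divides i - j, the
    second one by \<open>gw\<close>.\<close>
  have uniq: "[i = j] (mod m)" if R: "R x i" "R x j" for x i j
  proof -
    obtain e f where ef: "[x = g ^ i * w ^ e] (mod n)" "[x = g ^ j * w ^ f] (mod n)"
      using RE[OF R(1)] RE[OF R(2)] by blast
    hence "[g ^ i * w ^ e = g ^ j * w ^ f] (mod n)" by (metis cong_sym cong_trans)
    hence "[g ^ i * w ^ e * (w ^ e * g ^ ((m-1) * j)) = g ^ j * w ^ f * (w ^ e * g ^ ((m-1) * j))] (mod n)"
      by (rule cong_mult) simp
    moreover have "g ^ i * w ^ e * (w ^ e * g ^ ((m-1) * j)) = g ^ (i + (m-1) * j) * w ^ (2 * e)"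
      by (subst mult_2, simp only: power_add mult_ac)
    moreover have "g ^ j * w ^ f * (w ^ e * g ^ ((m-1) * j)) = (g ^ m) ^ j * w ^ (e + f)"
    proof -
      have "g ^ (j + (m-1) * j) = (g ^ m) ^ j"
        using m by (simp add: power_mult[symmetric] algebra_simps)
      thus ?thesis by (simp add: power_add algebra_simps)
    qed
    ultimately have 1: "[g ^ (i + (m-1) * j) * w ^ (2 * e) = (g ^ m) ^ j * w ^ (e + f)] (mod n)" by simp
    have "[g ^ (i + (m-1) * j) * w ^ (2 * e) = g ^ (i + (m-1) * j) * 1] (mod n)"
      using wpow[of "2 * e"] by (intro cong_mult) auto
    hence 2: "[g ^ (i + (m-1) * j) = g ^ (i + (m-1) * j) * w ^ (2 * e)] (mod n)" by (simp add: cong_sym)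
    have 3: "[(g ^ m) ^ j * w ^ (e + f) = 1 ^ j * (if even (e + f) then 1 else w)] (mod n)"
      using ord[of g n] unfolding m_def by (intro cong_mult cong_pow wpow) auto
    have "[g ^ (i + (m-1) * j) = (if even (e + f) then 1 else w)] (mod n)"
      using cong_trans[OF cong_trans[OF 2 1] 3] by simp
    hence d: "m dvd i + (m-1) * j"
      using gw[of "i + (m-1)*j"] by (auto simp: m_def ord_divides' split: if_splits)
    have "i + (m-1) * j + j = i + m * j" using m by (cases m) auto
    hence "(j + (i + (m-1) * j)) mod m = i mod m" by (metis add.commute mod_mult_self2)
    with d show ?thesis
      unfolding cong_def by (metis add.right_neutral dvd_eq_mod_eq_0 mod_add_right_eq)
  qed
  define ind where "ind = (\<lambda>x. SOME i. R x i)"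
  have ind: "R x (ind x)" if "coprime x n" for x
    unfolding ind_def using gen[OF that] by (intro someI_ex[of "R x"]) (auto simp: R_def)
  \<comment> \<open>A faithful additive character modulo \<open>m\<close>; applied to the index it
    becomes a multiplicative character modulo \<open>n\<close>.\<close>
  define E where "E = (\<lambda>i. cis (2 * pi * real i / real m))"
  have E_add: "E (i + j) = E i * E j" for i j
    by (simp add: E_def cis_mult algebra_simps add_divide_distrib)
  have E_dvd: "E i = 1" if "m dvd i" for i
  proof -
    obtain k where "i = m * k" using \<open>m dvd i\<close> by blast
    thus ?thesis using m cis_multiple_2pi[of "real k"] by (simp add: E_def mult_ac)
  qed
  have E_mod: "E i = E (i mod m)" for i
    using E_add[of "m * (i div m)" "i mod m"] E_dvd[of "m * (i div m)"] by simp
  have E_cong: "E i = E j" if "[i = j] (mod m)" for i j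
    using that E_mod[of i] E_mod[of j] by (simp add: cong_def)
  have E_1: "m dvd i" if "E i = 1" for i
  proof -
    have "inj_on E {..<m}"
      using Complex.bij_betw_roots_unity[OF m] by (simp add: bij_betw_def E_def)
    moreover have "E (i mod m) = E 0" using that E_mod[of i] by (simp add: E_def)
    ultimately have "i mod m = 0"
      using m by (auto dest: inj_onD)
    thus ?thesis by auto
  qed
  define \<psi> where "\<psi> = (\<lambda>x. if coprime x n then E (ind x) else 0)"
  have "\<psi> \<in> dchars n"
    unfolding dchars_def mem_Collect_eq
  proof (intro conjI allI impI)
    have "R 1 0" by (simp add: R_def)
    hence "E (ind 1) = E 0" by (intro E_cong uniq[of 1] ind) auto
    thus "\<psi> 1 = 1" by (simp add: \<psi>_def E_def)
  next
    fix x y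
    show "\<psi> (x * y) = \<psi> x * \<psi> y"
    proof (cases "coprime x n \<and> coprime y n")
      case True
      then obtain e f where "[x = g ^ ind x * w ^ e] (mod n)" "[y = g ^ ind y * w ^ f] (mod n)"
        using RE ind by meson
      from cong_mult[OF this] have "R (x * y) (ind x + ind y)"
        by (intro RI[of _ _ "e + f"]) (simp add: power_add mult_ac)
      hence "E (ind (x * y)) = E (ind x + ind y)"
        using True by (intro E_cong uniq[of "x * y"] ind) auto
      thus ?thesis using True by (simp add: \<psi>_def E_add)
    qed (auto simp: \<psi>_def)
  next
    fix x y assume xy: "[x = y] (mod n)"
    show "\<psi> x = \<psi> y"
    proof (cases "coprime x n")
      case True
      hence y: "coprime y n" using xy cong_imp_coprime by blast
      have "R x (ind y)" using ind[OF y] xy unfolding R_def by (metis cong_trans)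
      hence "E (ind x) = E (ind y)" using True by (intro E_cong uniq[of x] ind) auto
      thus ?thesis using True y by (simp add: \<psi>_def)
    next
      case False
      hence "\<not> coprime y n" using xy cong_imp_coprime cong_sym by blast
      thus ?thesis using False by (simp add: \<psi>_def)
    qed
  qed (auto simp: \<psi>_def E_def)
  moreover have "\<psi> a \<noteq> 1"
  proof
    \<comment> \<open>An index divisible by \<open>m\<close> leaves only the residues 1 and
      \<open>w\<close>, both excluded for \<open>a\<close>.\<close>
    assume "\<psi> a = 1"
    hence "m dvd ind a" using a by (auto simp: \<psi>_def intro!: E_1)
    hence "[g ^ ind a = 1] (mod n)" by (simp add: m_def ord_divides')
    hence 1: "[g ^ ind a = 1] (mod n)" "[g ^ ind a * w = 1 * w] (mod n)"
      by (blast intro: cong_mult cong_refl)+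
    thus False using ind[OF a(1)] a(2,3) unfolding R_def by (metis cong_trans mult_1)
  qed
  ultimately show ?thesis by blast
qed

section \<open>Separation of residues modulo prime powers\<close>

lemma dchars_separate_odd_prime_power:
  assumes "prime p" "odd p" "k > 0" "coprime a (p ^ k)" "\<not> [a = 1] (mod p ^ k)"
  shows "\<exists>\<psi>\<in>dchars (p ^ k). \<psi> a \<noteq> 1"
proof -
  obtain g where g: "residue_primroot (p ^ k) g"
    using residue_primroot_odd_prime_power_exists[OF assms(1,2)] assms(3) by metis
  have n: "p ^ k > 1" using assms prime_gt_1_nat[of p] one_less_power[of p k] by blast
  show ?thesis
  \<comment> \<open>With \<open>w = 1\<close> the second generator is trivial, and a primitive root
    reaches every unit.\<close>
  proof (rule dchars_exist_index[where g = g and w = 1])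
    show "coprime g (p ^ k)" using g by (auto simp: residue_primroot_def coprime_commute)
    show "ord (p ^ k) g dvd i" if "[g ^ i = 1] (mod p ^ k)" for i
      using that by (simp add: ord_divides')
  next
    fix x assume x: "coprime x (p ^ k)"
    have cop: "coprime (x mod p ^ k) (p ^ k)"
      using x prime_gt_0_nat[OF assms(1)] by (subst coprime_mod_left_iff) auto
    hence "x mod p ^ k \<noteq> 0" using n by (intro notI) auto
    hence "x mod p ^ k \<in> totatives (p ^ k)"
      using cop mod_less_divisor[of "p ^ k" x] n unfolding totatives_def mem_Collect_eq greaterThanAtMost_iff
      by (meson gr0I less_imp_le less_trans zero_less_one)
    then obtain i where "x mod p ^ k = g ^ i mod p ^ k"
      using residue_primroot_is_generator[OF n g] unfolding bij_betw_def by auto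
    thus "\<exists>i. [x = g ^ i] (mod p ^ k) \<or> [x = g ^ i * 1] (mod p ^ k)"
      by (auto simp: cong_def)
  qed (use assms prime_gt_0_nat[of p] in auto)
qed

text \<open>By counting: 5 has order \<open>2 ^ (k - 2)\<close> modulo \<open>2 ^ k\<close>, which
  is also the number of residues congruent to 1 modulo 4, and all powers of 5 are among those
  residues.\<close>

lemma cong_1_mod_4_imp_power_of_5:
  fixes x :: nat
  assumes k: "k \<ge> 3" and x: "[x = 1] (mod 4)"
  shows "\<exists>i. [x = 5 ^ i] (mod 2 ^ k)"
proof -
  have ord5: "ord (2 ^ k) (5 :: nat) = 2 ^ (k - 2)"
    using ord_twopow_3_5[of k 5] k by simp
  have dvd4: "(4::nat) dvd 2 ^ k"
    using le_imp_power_dvd[of 2 k "2::nat"] k by simp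
  define T where "T = {y\<in>{..<2 ^ k}. y mod 4 = (1::nat)}"
  have "T = (\<lambda>j. 4 * j + 1) ` {..<2 ^ (k - 2)}"
  proof -
    have k4: "(2::nat) ^ k = 4 * 2 ^ (k - 2)"
    proof -
      obtain j where "k = Suc (Suc j)" using k that[of "k - 2"] by simp
      thus ?thesis by simp
    qed
    have "y \<in> (\<lambda>j. 4 * j + 1) ` {..<2 ^ (k - 2)}" if "y \<in> T" for y
    proof -
      have "y = 4 * (y div 4) + 1" "y < 4 * 2 ^ (k - 2)" using that k4 by (auto simp: T_def) presburger
      thus ?thesis by (intro image_eqI[of _ _ "y div 4"]) auto
    qed
    moreover have "4 * j + 1 \<in> T" if "j < 2 ^ (k - 2)" for j
      using that k4 unfolding T_def by (auto simp: mod_Suc) 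
    ultimately show ?thesis by blast
  qed
  hence cT: "card T = 2 ^ (k - 2)"
    by (simp add: card_image inj_on_def)
  define e where "e = (\<lambda>i. (5::nat) ^ i mod 2 ^ k)"
  have "inj_on e {..<2 ^ (k - 2)}"
  proof (rule inj_onI)
    fix i j assume *: "i \<in> {..<2 ^ (k - 2)}" "j \<in> {..<2 ^ (k - 2 :: nat)}" "e i = e j"
    have "[5 ^ i = (5::nat) ^ j] (mod 2 ^ k)" using *(3) by (simp add: e_def cong_def)
    hence "[i = j] (mod 2 ^ (k - 2))"
      by (subst (asm) order_divides_expdiff) (simp_all add: ord5)
    thus "i = j" using * by (simp add: cong_def)
  qed
  moreover have "e ` {..<2 ^ (k - 2)} \<subseteq> T"
  proof
    fix y assume "y \<in> e ` {..<2 ^ (k - 2)}"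
    then obtain i where "y = 5 ^ i mod 2 ^ k" by (auto simp: e_def)
    moreover have "5 ^ i mod 4 = (1::nat)" by (simp add: power_mod[of 5 4 i, symmetric])
    ultimately show "y \<in> T"
      using dvd4 by (simp add: T_def mod_mod_cancel)
  qed
  ultimately have "e ` {..<2 ^ (k - 2)} = T"
    using cT by (intro card_subset_eq) (auto simp: T_def card_image)
  moreover have "x mod 2 ^ k \<in> T"
    using x dvd4 by (simp add: T_def cong_def mod_mod_cancel)
  ultimately obtain i where "x mod 2 ^ k = e i" by auto
  thus ?thesis by (auto simp: e_def cong_def)
qed

text \<open>The character built from the exponent of 5 is trivial at both 1 and -1. It separates
  every other residue from 1; the residue -1 is left to the nontrivial character modulo 4.\<close>

lemma dchars_separate_power_of_2:
  assumes k: "k \<ge> 3" and a: "coprime a (2 ^ k)" "\<not> [a = 1] (mod 2 ^ k)"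
  shows "\<exists>\<psi>\<in>dchars (2 ^ k). \<psi> a \<noteq> 1"
proof -
  define w where "w = (2::nat) ^ k - 1"
  have w: "w + 1 = 2 ^ k" by (simp add: w_def)
  have dvd4: "(4::nat) dvd 2 ^ k"
    using le_imp_power_dvd[of 2 k "2::nat"] k by simp
  have w4: "w mod 4 = 3"
    using dvd4 unfolding w[symmetric] by presburger
  have ww: "[w * w = 1] (mod 2 ^ k)"
  proof -
    have "w * w + 2 * (w + 1) = 1 + (w + 1) * (w + 1)" by (simp add: algebra_simps)
    hence "[w * w + 2 * 2 ^ k = 1 + 2 ^ k * 2 ^ k] (mod 2 ^ k)" by (simp only: w cong_refl)
    thus ?thesis unfolding cong_def mod_mult_self1 by simp
  qed
  have odd: "odd x" if "coprime x (2 ^ k)" for x :: nat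
    using that k by auto
  show ?thesis
  proof (cases "[a = w] (mod 2 ^ k)")
    case False
    show ?thesis
    proof (rule dchars_exist_index[where g = 5 and w = w])
      \<comment> \<open>The premise is contradictory: powers of 5 are 1 modulo 4, while
        \<open>w\<close> is 3.\<close>
      fix i assume "[5 ^ i = w] (mod 2 ^ k)"
      hence "[5 ^ i = w] (mod 4)" using dvd4 cong_dvd_modulus_nat by blast
      moreover have "5 ^ i mod 4 = (1::nat)" by (simp add: power_mod[of 5 4 i, symmetric])
      ultimately show "ord (2 ^ k) 5 dvd i" using w4 by (simp add: cong_def)
    next
      fix x :: nat assume x: "coprime x (2 ^ k)"
      show "\<exists>i. [x = 5 ^ i] (mod 2 ^ k) \<or> [x = 5 ^ i * w] (mod 2 ^ k)"
      proof (cases "x mod 4 = 1")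
        case True
        thus ?thesis using cong_1_mod_4_imp_power_of_5[OF k, of x] by (auto simp: cong_def)
      next
        case False
        hence "x mod 4 = 3" using odd[OF x] by presburger
        \<comment> \<open>Multiplying by \<open>w\<close>, its own inverse, moves \<open>x\<close>
          into the class of 1 modulo 4.\<close>
        hence "x * w mod 4 = 3 * 3 mod 4" by (metis mod_mult_eq w4)
        hence "x * w mod 4 = 1" by simp
        then obtain i where "[x * w = 5 ^ i] (mod 2 ^ k)"
          using cong_1_mod_4_imp_power_of_5[OF k, of "x * w"] by (auto simp: cong_def)
        hence "[x * w * w = 5 ^ i * w] (mod 2 ^ k)" by (intro cong_mult) auto
        moreover have "[x * (w * w) = x * 1] (mod 2 ^ k)" by (intro cong_mult ww) auto
        ultimately have "[x = 5 ^ i * w] (mod 2 ^ k)"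
          by (metis cong_sym cong_trans mult.assoc mult.right_neutral)
        thus ?thesis by blast
      qed
    qed (use ww a False in auto)
  next
    case True
    hence "[a = w] (mod 4)" using dvd4 cong_dvd_modulus_nat by blast
    hence a4: "a mod 4 = 3" using w4 by (simp add: cong_def)
    define \<psi> where "\<psi> = (\<lambda>x::nat. if even x then 0 else if x mod 4 = 1 then 1 else -1 :: complex)"
    have "\<psi> \<in> dchars (2 ^ k)"
      unfolding dchars_def mem_Collect_eq
    proof (intro conjI allI impI)
      fix x y :: nat
      have \<psi>: "\<psi> z = (if z mod 4 = 1 then 1 else if z mod 4 = 3 then -1 else 0)" for z
        unfolding \<psi>_def by (auto; presburger)
      have "x mod 4 = 0 \<or> x mod 4 = 1 \<or> x mod 4 = 2 \<or> x mod 4 = 3"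
        "y mod 4 = 0 \<or> y mod 4 = 1 \<or> y mod 4 = 2 \<or> y mod 4 = 3" by presburger+
      moreover have "(x * y) mod 4 = ((x mod 4) * (y mod 4)) mod 4" by (simp add: mod_mult_eq)
      ultimately show "\<psi> (x * y) = \<psi> x * \<psi> y" unfolding \<psi>
        by (elim disjE) (simp_all only:, simp_all)
    next
      fix x y :: nat assume "[x = y] (mod 2 ^ k)"
      hence "[x = y] (mod 4)" using dvd4 cong_dvd_modulus_nat by blast
      moreover from this have "even x = even y" unfolding cong_def by presburger
      ultimately show "\<psi> x = \<psi> y" by (simp add: \<psi>_def cong_def)
    next
      fix x :: nat
      show "\<psi> x = 0 \<longleftrightarrow> \<not> coprime x (2 ^ k)" using k by (auto simp: \<psi>_def)
    qed (simp add: \<psi>_def)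
    moreover have "\<psi> a \<noteq> 1" using a4 odd[OF a(1)] by (simp add: \<psi>_def)
    ultimately show ?thesis by blast
  qed
qed

section \<open>Continuation of L-series to the right half-plane\<close>

text \<open>Mean value inequality: on the interval the derivative of \<open>z powr (-s)\<close> is
  largest in norm at its left end.\<close>

lemma powr_lipschitz_bound:
  fixes s :: complex and x h t :: real
  assumes "x > 0" "Re s > 0" "t \<in> {x..x + h}"
  shows "norm (of_real x powr (-s) - of_real t powr (-s)) \<le> norm s * h * x powr (- Re s - 1)"
proof -
  define S where "S = complex_of_real ` {x..x + h}"
  have S: "convex S" unfolding S_def
    by (intro convex_linear_image bounded_linear.linear bounded_linear_of_real convex_real_interval)
  have "norm (of_real x powr (-s) - of_real t powr (-s)) \<le>
          (norm s * x powr (- Re s - 1)) * norm (complex_of_real x - of_real t)"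
  proof (rule field_differentiable_bound[OF S, where f' = "\<lambda>z. -s * z powr (-s - 1)"])
    fix z assume "z \<in> S"
    then obtain u where u: "z = of_real u" "u \<ge> x" by (auto simp: S_def)
    hence "z \<notin> \<real>\<^sub>\<le>\<^sub>0" using assms by (auto simp: complex_nonpos_Reals_iff)
    thus "((\<lambda>z. z powr (-s)) has_field_derivative -s * z powr (-s - 1)) (at z within S)"
      using has_field_derivative_powr[of z "-s"] has_field_derivative_at_within by blast
    have "u powr (- Re s - 1) \<le> x powr (- Re s - 1)"
      using u assms by (intro powr_mono2') auto
    thus "norm (-s * z powr (-s - 1)) \<le> norm s * x powr (- Re s - 1)"
      using u assms by (simp add: norm_mult norm_powr_real_powr mult_left_mono)
  qed (use assms in \<open>auto simp: S_def\<close>)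
  also have "norm (complex_of_real x - of_real t) \<le> h"
    using assms(3) by (simp flip: of_real_diff)
  finally show ?thesis
    using assms by (simp add: mult_left_mono mult_ac mult_right_mono)
qed

text \<open>This is s - 1 times the difference between the value of t^(-s) at \<open>x\<close> and
  its mean over [x, x + h]. With the integral evaluated in closed form, the expression still makes
  sense at s = 1.\<close>

definition hurwitz_term :: "real \<Rightarrow> real \<Rightarrow> complex \<Rightarrow> complex" where
  "hurwitz_term h x s = (s - 1) * of_real x powr (-s) - (of_real x powr (1 - s) - of_real (x + h) powr (1 - s)) / of_real h"

text \<open>Replacing a value by a mean gains one power of \<open>x\<close>, which is what makes the
  series converge for \<open>Re s > 0\<close>. The term is the increment of \<open>g\<close> divided
  by \<open>h\<close>, and the derivative of \<open>g\<close> is controlled by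
  \<open>powr_lipschitz_bound\<close>.\<close>

lemma norm_hurwitz_term_le:
  fixes s :: complex and x h :: real
  assumes "x > 0" "h > 0" "Re s > 0"
  shows "norm (hurwitz_term h x s) \<le> norm (s - 1) * norm s * h * x powr (- Re s - 1)"
proof -
  define S where "S = complex_of_real ` {x..x + h}"
  define g where "g = (\<lambda>z. z powr (1 - s) + (s - 1) * of_real x powr (-s) * (z - of_real x))"
  have S: "convex S" unfolding S_def
    by (intro convex_linear_image bounded_linear.linear bounded_linear_of_real convex_real_interval)
  have "norm (g (of_real (x + h)) - g (of_real x)) \<le>
          (norm (s - 1) * (norm s * h * x powr (- Re s - 1))) * norm (complex_of_real (x + h) - of_real x)"
  proof (rule field_differentiable_bound[OF S, where f' = "\<lambda>z. (s - 1) * (of_real x powr (-s) - z powr (-s))"])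
    fix z assume "z \<in> S"
    then obtain u where u: "z = of_real u" "u \<in> {x..x + h}" by (auto simp: S_def)
    hence "z \<notin> \<real>\<^sub>\<le>\<^sub>0" using assms by (auto simp: complex_nonpos_Reals_iff)
    hence "(g has_field_derivative (1 - s) * z powr (1 - s - 1) + (s - 1) * of_real x powr (-s) * (1 - 0)) (at z)"
      unfolding g_def by (intro DERIV_add DERIV_cmult DERIV_diff DERIV_ident DERIV_const has_field_derivative_powr)
    also have "(1 - s) * z powr (1 - s - 1) + (s - 1) * of_real x powr (-s) * (1 - 0) =
                 (s - 1) * (of_real x powr (-s) - z powr (-s))"
      by (simp add: algebra_simps)
    finally show "(g has_field_derivative (s - 1) * (of_real x powr (-s) - z powr (-s))) (at z within S)"
      by (rule has_field_derivative_at_within)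
    show "norm ((s - 1) * (of_real x powr (-s) - z powr (-s))) \<le> norm (s - 1) * (norm s * h * x powr (- Re s - 1))"
      unfolding norm_mult u(1) by (intro mult_left_mono powr_lipschitz_bound assms u(2)) auto
  qed (use assms in \<open>auto simp: S_def simp del: of_real_add\<close>)
  also have "norm (complex_of_real (x + h) - of_real x) = h"
    using assms by simp
  finally have *: "norm (g (of_real (x + h)) - g (of_real x)) / h \<le> norm (s - 1) * norm s * h * x powr (- Re s - 1)"
    using assms by (simp add: field_simps)
  have "hurwitz_term h x s = (g (of_real (x + h)) - g (of_real x)) / of_real h"
    using assms by (simp add: hurwitz_term_def g_def field_simps)
  hence "norm (hurwitz_term h x s) = norm (g (of_real (x + h)) - g (of_real x)) / h"
    using assms by (simp add: norm_divide)
  with * show ?thesis by simp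
qed

lemma summable_Suc_powr:
  assumes "a > 1"
  shows "summable (\<lambda>m. real (Suc m) powr (- a))"
  using assms summable_Suc_iff[of "\<lambda>m. real m powr (-a)"] by (simp add: summable_real_powr_iff del: of_nat_Suc)

text \<open>\<open>(s - 1) \<Sum>\<^sub>m (m n + r)\<^sup>-\<^sup>s\<close>, written so that it converges for \<open>Re s > 0\<close>.\<close>
definition hurwitz_ext :: "nat \<Rightarrow> nat \<Rightarrow> complex \<Rightarrow> complex" where
  "hurwitz_ext n r s = of_nat r powr (1 - s) / of_nat n + (\<Sum>m. hurwitz_term (real n) (real (m * n + r)) s)"

text \<open>The partial sums are holomorphic and converge uniformly on a closed disc around each
  point, by the Weierstrass M-test.\<close>

lemma holomorphic_hurwitz_ext:
  assumes n: "n > 0" and r: "r > 0"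
  shows "hurwitz_ext n r holomorphic_on {s. Re s > 0}"
proof -
  define T where "T = (\<lambda>m s. hurwitz_term (real n) (real (m * n + r)) s)"
  have hol: "T m holomorphic_on A" for m A
    unfolding T_def hurwitz_term_def using n r by (auto intro!: holomorphic_intros simp del: of_nat_add of_nat_mult)
  have "(\<lambda>s. \<Sum>m. T m s) holomorphic_on {s. Re s > 0}"
  proof (rule holomorphic_uniform_sequence[where f = "\<lambda>N s. \<Sum>m<N. T m s"])
    show "open {s. 0 < Re s}" by (simp add: open_halfspace_Re_gt)
    show "(\<lambda>s. \<Sum>m<N. T m s) holomorphic_on {s. 0 < Re s}" for N
      by (intro holomorphic_intros hol)
    fix z assume z: "z \<in> {s. 0 < Re s}"
    \<comment> \<open>Half of \<open>Re z\<close> keeps the closed disc in the region where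
      \<open>Re s\<close> is at least \<open>d\<close>, so one convergent majorant serves the whole
      disc.\<close>
    define d where "d = Re z / 2"
    have d: "d > 0" using z by (simp add: d_def)
    define R where "R = norm z + d + 1"
    have ball: "Re s \<ge> d" "norm s \<le> R" "norm (s - 1) \<le> R" if "s \<in> cball z d" for s
    proof -
      have *: "norm (z - s) \<le> d" using that by (simp add: dist_norm)
      have "Re (z - s) \<le> d" using complex_Re_le_cmod[of "z - s"] * by linarith
      thus "Re s \<ge> d" by (simp add: d_def)
      have "norm s \<le> norm z + d" using * norm_triangle_ineq3[of z s] by linarith
      thus "norm s \<le> R" "norm (s - 1) \<le> R"
        using norm_triangle_ineq4[of s 1] by (auto simp: R_def)
    qed
    have "uniform_limit (cball z d) (\<lambda>N s. \<Sum>m<N. T m s) (\<lambda>s. \<Sum>m. T m s) sequentially"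
    proof (rule Weierstrass_m_test)
      show "summable (\<lambda>m. R * R * real n * real (Suc m) powr (- (d + 1)))"
        using d by (intro summable_mult summable_Suc_powr) auto
      fix m s assume s: "s \<in> cball z d"
      have x: "real (m * n + r) \<ge> real (Suc m)"
        unfolding of_nat_le_iff using n r by (cases n) auto
      have "norm (T m s) \<le> norm (s - 1) * norm s * real n * real (m * n + r) powr (- Re s - 1)"
        unfolding T_def using n r ball(1)[OF s] d by (intro norm_hurwitz_term_le) (auto simp del: of_nat_add of_nat_mult)
      also have "\<dots> \<le> R * R * real n * real (Suc m) powr (- (d + 1))"
      proof (intro mult_mono ball[OF s])
        have "real (m * n + r) powr (- Re s - 1) \<le> real (Suc m) powr (- Re s - 1)"
          using x ball(1)[OF s] d by (intro powr_mono2') auto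
        also have "\<dots> \<le> real (Suc m) powr (- (d + 1))"
          using ball(1)[OF s] by (intro powr_mono) auto
        finally show "real (m * n + r) powr (- Re s - 1) \<le> real (Suc m) powr (- (d + 1))" .
      qed (use ball[OF s] norm_ge_zero[of s] d in \<open>auto simp: R_def\<close>)
      finally show "norm (T m s) \<le> R * R * real n * real (Suc m) powr (- (d + 1))" .
    qed
    moreover have "cball z d \<subseteq> {s. 0 < Re s}" using ball(1) d by fastforce
    ultimately show "\<exists>d>0. cball z d \<subseteq> {s. 0 < Re s} \<and>
        uniform_limit (cball z d) (\<lambda>N s. \<Sum>m<N. T m s) (\<lambda>s. \<Sum>m. T m s) sequentially"
      using d by blast
  qed
  thus ?thesis
    unfolding hurwitz_ext_def[abs_def] T_def using n r by (intro holomorphic_intros) auto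
qed

text \<open>Each \<open>hurwitz_term\<close> vanishes at s = 1, so only the leading term remains; it
  is the residue there of the sum over the progression.\<close>

lemma hurwitz_ext_at_1: "n > 0 \<Longrightarrow> r > 0 \<Longrightarrow> hurwitz_ext n r 1 = 1 / of_nat n"
  by (simp add: hurwitz_ext_def hurwitz_term_def flip: of_real_add of_nat_add of_nat_mult)

lemma norm_of_nat_powr: "m > 0 \<Longrightarrow> norm (of_nat m powr s :: complex) = real m powr Re s"
  using norm_powr_real_powr[of "real m" s] by simp

lemma norm_powr_progression_le:
  assumes "n > 0" "r > 0" "Re s > 0"
  shows "norm (of_nat (m * n + r) powr (-s) :: complex) \<le> real (Suc m) powr (- Re s)"
proof -
  have "real (m * n + r) \<ge> real (Suc m)"
    unfolding of_nat_le_iff using assms by (cases n) auto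
  thus ?thesis using assms
    by (subst norm_of_nat_powr) (auto intro!: powr_mono2')
qed

lemma summable_powr_progression:
  assumes "n > 0" "r > 0" "Re s > 1"
  shows "summable (\<lambda>m. of_nat (m * n + r) powr (-s) :: complex)"
  using assms by (intro summable_comparison_test'[OF summable_Suc_powr[of "Re s"]] norm_powr_progression_le) auto

text \<open>The subtracted means telescope. Their total is \<open>y 0\<close>, the leading term of
  \<open>hurwitz_ext\<close>, because \<open>y\<close> tends to 0 when
  \<open>Re s > 1\<close>.\<close>

lemma hurwitz_ext_eq:
  assumes n: "n > 0" and r: "r > 0" and s: "Re s > 1"
  shows "hurwitz_ext n r s = (s - 1) * (\<Sum>m. of_nat (m * n + r) powr (-s))"
proof -
  define y where "y = (\<lambda>m. of_nat (m * n + r) powr (1 - s) / of_nat n :: complex)"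
  have "(\<lambda>m. norm (y m)) \<longlonglongrightarrow> 0"
  proof (rule tendsto_sandwich[OF always_eventually always_eventually tendsto_const])
    have "(\<lambda>m. real (Suc m) powr (- (Re s - 1))) \<longlonglongrightarrow> 0"
      using s by (intro tendsto_neg_powr filterlim_compose[OF filterlim_real_sequentially] filterlim_Suc) auto
    thus "(\<lambda>m. real (Suc m) powr (- (Re s - 1))) \<longlonglongrightarrow> 0" .
    show "\<forall>m. 0 \<le> norm (y m)" by simp
    show "\<forall>m. norm (y m) \<le> real (Suc m) powr (- (Re s - 1))"
    proof
      fix m
      have "norm (y m) \<le> norm (of_nat (m * n + r) powr (- (s - 1)) :: complex)"
        using n by (simp add: y_def norm_divide divide_le_eq mult_left_le_one_le mult_le_cancel_left1)
      also have "\<dots> \<le> real (Suc m) powr (- Re (s - 1))"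
        using n r s by (intro norm_powr_progression_le) auto
      finally show "norm (y m) \<le> real (Suc m) powr (- (Re s - 1))" by simp
    qed
  qed
  hence "y \<longlonglongrightarrow> 0" by (simp add: tendsto_norm_zero_iff)
  hence "(\<lambda>m. y m - y (Suc m)) sums (y 0 - 0)" by (rule telescope_sums')
  hence *: "(\<lambda>m. y m - y (Suc m)) sums y 0" by simp
  have "(\<lambda>m. (s - 1) * of_nat (m * n + r) powr (-s) - (y m - y (Suc m))) sums
          ((s - 1) * (\<Sum>m. of_nat (m * n + r) powr (-s)) - y 0)"
    by (intro sums_diff sums_mult summable_sums summable_powr_progression * assms)
  moreover have "hurwitz_term (real n) (real (m * n + r)) s =
      (s - 1) * of_nat (m * n + r) powr (-s) - (y m - y (Suc m))" for m
    by (simp add: hurwitz_term_def y_def diff_divide_distrib algebra_simps)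
  ultimately have "(\<Sum>m. hurwitz_term (real n) (real (m * n + r)) s) =
      (s - 1) * (\<Sum>m. of_nat (m * n + r) powr (-s)) - y 0"
    by (simp add: sums_iff)
  thus ?thesis by (simp add: hurwitz_ext_def y_def)
qed

definition dirichlet_L :: "(nat \<Rightarrow> complex) \<Rightarrow> complex \<Rightarrow> complex" where
  "dirichlet_L \<xi> s = (\<Sum>m. \<xi> (Suc m) * of_nat (Suc m) powr (-s))"

text \<open>A continuation of (s - 1) L(s, \<xi>). The residue classes are represented by 1, ..., n,
  so that every progression starts at a positive integer.\<close>

definition dirichlet_L_ext :: "nat \<Rightarrow> (nat \<Rightarrow> complex) \<Rightarrow> complex \<Rightarrow> complex" where
  "dirichlet_L_ext n \<xi> s = (\<Sum>r<n. \<xi> (Suc r) * hurwitz_ext n (Suc r) s)"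

lemma holomorphic_dirichlet_L_ext: "n > 0 \<Longrightarrow> dirichlet_L_ext n \<xi> holomorphic_on {s. Re s > 0}"
  unfolding dirichlet_L_ext_def[abs_def] by (intro holomorphic_intros holomorphic_hurwitz_ext) auto

lemma dirichlet_L_ext_eq:
  assumes n: "n > 0" and s: "Re s > 1" and \<xi>: "\<And>a. norm (\<xi> a) \<le> 1"
    and per: "\<And>a b. [a = b] (mod n) \<Longrightarrow> \<xi> a = \<xi> b"
  shows "dirichlet_L_ext n \<xi> s = (s - 1) * dirichlet_L \<xi> s"
proof -
  define f where "f = (\<lambda>m. \<xi> (Suc m) * of_nat (Suc m) powr (-s))"
  have "summable f"
  proof (rule summable_comparison_test'[OF summable_Suc_powr[OF s]])
    fix m :: nat
    show "norm (f m) \<le> real (Suc m) powr (- Re s)"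
      using \<xi>[of "Suc m"] by (simp add: f_def norm_mult norm_of_nat_powr mult_left_le_one_le del: of_nat_Suc)
  qed
  hence "f sums dirichlet_L \<xi> s" by (simp add: dirichlet_L_def f_def summable_sums)
  \<comment> \<open>Grouping into blocks of length \<open>n\<close> meets each residue class once
    per block.\<close>
  hence 1: "(\<lambda>m. sum f {m * n..<m * n + n}) sums dirichlet_L \<xi> s"
    by (intro sums_group n)
  have 2: "sum f {m * n..<m * n + n} = (\<Sum>r<n. \<xi> (Suc r) * of_nat (m * n + Suc r) powr (-s))" for m
  proof -
    have "sum f {m * n..<m * n + n} = (\<Sum>r<n. f (m * n + r))"
      using sum.shift_bounds_nat_ivl[of f 0 "m * n" n] by (simp add: add.commute lessThan_atLeast0)
    also have "\<dots> = (\<Sum>r<n. \<xi> (Suc r) * of_nat (m * n + Suc r) powr (-s))"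
    proof (rule sum.cong)
      fix r
      have "\<xi> (Suc (m * n + r)) = \<xi> (Suc r)" by (rule per) (simp add: cong_def flip: add_Suc_right)
      thus "f (m * n + r) = \<xi> (Suc r) * of_nat (m * n + Suc r) powr (-s)"
        by (simp add: f_def)
    qed auto
    finally show ?thesis .
  qed
  have "(\<lambda>m. \<Sum>r<n. \<xi> (Suc r) * of_nat (m * n + Suc r) powr (-s)) sums
          (\<Sum>r<n. \<xi> (Suc r) * (\<Sum>m. of_nat (m * n + Suc r) powr (-s)))"
    using n s by (intro sums_sum sums_mult summable_sums summable_powr_progression) auto
  with 1 have "dirichlet_L \<xi> s = (\<Sum>r<n. \<xi> (Suc r) * (\<Sum>m. of_nat (m * n + Suc r) powr (-s)))"
    unfolding 2 using sums_unique2 by blast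
  thus ?thesis
    using n s by (simp add: dirichlet_L_ext_def hurwitz_ext_eq sum_distrib_left mult_ac del: of_nat_add of_nat_mult of_nat_Suc)
qed

section \<open>Euler products\<close>

lemma of_nat_mult_powr: "of_nat (a * b) powr s = (of_nat a powr s * of_nat b powr s :: complex)"
  using powr_times_real[of "of_nat a" "of_nat b" s] by simp

text \<open>Unordered sums over arbitrary index sets allow the series to be split by divisibility.
  The term at 0 vanishes because \<open>0 powr (-s)\<close> is 0.\<close>

lemma abs_summable_dirichlet:
  assumes "\<And>a. norm (\<xi> a) \<le> 1" "Re s > 1"
  shows "(\<lambda>m. norm (\<xi> m * of_nat m powr (-s) :: complex)) summable_on A"
proof -
  have "(\<lambda>m. norm (\<xi> m * of_nat m powr (-s) :: complex)) summable_on UNIV"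
  proof (rule summable_on_comparison_test)
    show "(\<lambda>m. real m powr (- Re s)) summable_on UNIV"
      using assms(2) by (subst summable_on_UNIV_nonneg_real_iff) (auto simp: summable_real_powr_iff)
    fix m :: nat
    show "norm (\<xi> m * of_nat m powr (-s) :: complex) \<le> real m powr (- Re s)"
      using assms(1)[of m] by (cases "m = 0") (auto simp: norm_mult norm_of_nat_powr mult_left_le_one_le)
  qed auto
  thus ?thesis using summable_on_subset_banach by blast
qed

lemma dirichlet_L_eq_infsum:
  assumes "\<And>a. norm (\<xi> a) \<le> 1" "Re s > 1"
  shows "dirichlet_L \<xi> s = infsum (\<lambda>m. \<xi> m * of_nat m powr (-s)) {0<..}"
proof -
  define f where "f = (\<lambda>m. \<xi> m * of_nat m powr (-s) :: complex)"
  have "f summable_on range Suc"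
    unfolding f_def by (rule abs_summable_summable[OF abs_summable_dirichlet[OF assms]])
  hence "(f has_sum infsum f (range Suc)) (range Suc)" by simp
  hence "((f \<circ> Suc) has_sum infsum f (range Suc)) UNIV"
    by (subst (asm) has_sum_reindex) auto
  hence "(f \<circ> Suc) sums infsum f (range Suc)" by (rule has_sum_imp_sums)
  moreover have "range Suc = {0<..}" by (auto simp: image_iff gr0_conv_Suc)
  ultimately show ?thesis by (simp add: dirichlet_L_def sums_iff f_def o_def)
qed

text \<open>A sieve: the factor for \<open>p\<close> removes the multiples of \<open>p\<close>. The
  integers prime to \<open>Q\<close> split into those not divisible by \<open>p\<close> and
  \<open>p\<close> times the whole set, and the terms are completely multiplicative.\<close>

lemma euler_product_finite:
  assumes n: "n > 0" and \<xi>: "\<xi> \<in> dchars n" and s: "Re s > 1"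
    and Q: "finite Q" "\<And>q. q \<in> Q \<Longrightarrow> prime q"
  shows "(\<Prod>q\<in>Q. 1 - \<xi> q * of_nat q powr (-s)) * dirichlet_L \<xi> s =
           infsum (\<lambda>m. \<xi> m * of_nat m powr (-s)) {m. m > 0 \<and> (\<forall>q\<in>Q. \<not> q dvd m)}"
  using Q
proof (induction Q rule: finite_induct)
  case empty
  have "{m::nat. m > 0 \<and> (\<forall>q\<in>{}. \<not> q dvd m)} = {0<..}" by auto
  thus ?case by (simp add: dirichlet_L_eq_infsum norm_dchars_le_1[OF \<xi> n] s)
next
  case (insert p Q)
  define f where "f = (\<lambda>m. \<xi> m * of_nat m powr (-s) :: complex)"
  have summ: "f summable_on A" for A
    unfolding f_def by (rule abs_summable_summable[OF abs_summable_dirichlet[OF norm_dchars_le_1[OF \<xi> n] s]])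
  define S where "S = {m. m > 0 \<and> (\<forall>q\<in>Q. \<not> q dvd m)}"
  define S' where "S' = {m. m > 0 \<and> (\<forall>q\<in>insert p Q. \<not> q dvd m)}"
  have p: "prime p" using insert.prems by auto
  have S: "S = S' \<union> (\<lambda>m. p * m) ` S"
  proof (intro equalityI subsetI)
    fix m assume m: "m \<in> S"
    show "m \<in> S' \<union> (\<lambda>m. p * m) ` S"
    proof (cases "p dvd m")
      case True
      then obtain k where "m = p * k" by blast
      hence "k \<in> S" using m by (auto simp: S_def)
      thus ?thesis using \<open>m = p * k\<close> by blast
    qed (use m in \<open>auto simp: S_def S'_def\<close>)
  next
    fix m assume "m \<in> S' \<union> (\<lambda>m. p * m) ` S"
    moreover have "p * k \<in> S" if "k \<in> S" for k
    proof -
      have "\<not> q dvd p * k" if "q \<in> Q" for q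
      proof
        assume "q dvd p * k"
        moreover have "prime q" using insert.prems that by auto
        ultimately have "q dvd p \<or> q dvd k" by (simp add: prime_dvd_mult_iff)
        moreover have "\<not> q dvd k" using \<open>k \<in> S\<close> that by (auto simp: S_def)
        moreover have "\<not> q dvd p"
          using \<open>prime q\<close> p primes_dvd_imp_eq[of q p] that insert.hyps by blast
        ultimately show False by blast
      qed
      thus ?thesis using that prime_gt_0_nat[OF p] by (auto simp: S_def)
    qed
    ultimately show "m \<in> S" by (auto simp: S_def S'_def)
  qed
  have "S' \<inter> (\<lambda>m. p * m) ` S = {}" by (auto simp: S'_def)
  hence 1: "infsum f S = infsum f S' + infsum f ((\<lambda>m. p * m) ` S)"
    using S infsum_Un_disjoint[OF summ summ] by metis
  have 2: "infsum f ((\<lambda>m. p * m) ` S) = infsum (\<lambda>m. f (p * m)) S"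
    using prime_gt_0_nat[OF p] by (subst infsum_reindex) (auto simp: inj_on_def o_def)
  have "(\<lambda>m. f (p * m)) = (\<lambda>m. f p * f m)"
    unfolding f_def dchars_mult[OF \<xi>] of_nat_mult_powr by (simp add: mult_ac)
  hence 3: "infsum (\<lambda>m. f (p * m)) S = f p * infsum f S"
    by (simp only: infsum_cmult_right')
  have "(1 - f p) * x = y" if "x = y + z" "z = w" "w = f p * x" for x y z w :: complex
    using that by (simp add: left_diff_distrib diff_eq_eq)
  from this[OF 1 2 3] have "(1 - f p) * infsum f S = infsum f S'" .
  moreover have "(\<Prod>q\<in>Q. 1 - \<xi> q * of_nat q powr (-s)) * dirichlet_L \<xi> s = infsum f S"
    unfolding f_def S_def using insert by auto
  ultimately show ?case
    using insert.hyps unfolding S'_def f_def by (simp add: mult.assoc)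
qed

section \<open>Convergence of Euler products\<close>

definition primes_le :: "nat \<Rightarrow> nat set" where
  "primes_le N = {q. prime q \<and> q \<le> N}"

lemma finite_primes_le [simp]: "finite (primes_le N)"
  unfolding primes_le_def by (rule finite_subset[of _ "{..N}"]) auto

text \<open>After sieving by all primes up to \<open>N\<close>, an integer other than 1 that
  survives has a prime factor above \<open>N\<close>, hence exceeds \<open>N\<close> itself. The
  resulting tail bound depends on neither \<xi> nor s.\<close>

lemma euler_product_error:
  assumes n: "n > 0" and \<xi>: "\<xi> \<in> dchars n" and \<sigma>: "\<sigma> > 1" and s: "Re s \<ge> \<sigma>"
  shows "norm ((\<Prod>q\<in>primes_le N. 1 - \<xi> q * of_nat q powr (-s)) * dirichlet_L \<xi> s - 1) \<le>
           (\<Sum>k. real (Suc (k + N)) powr (- \<sigma>))"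
proof -
  define f where "f = (\<lambda>m. \<xi> m * of_nat m powr (-s) :: complex)"
  have s': "Re s > 1" using \<sigma> s by simp
  have abs: "(\<lambda>m. norm (f m)) summable_on A" for A
    unfolding f_def by (intro abs_summable_dirichlet norm_dchars_le_1[OF \<xi> n] s')
  define S where "S = {m. m > 0 \<and> (\<forall>q\<in>primes_le N. \<not> q dvd m)}"
  define h where "h = (\<lambda>k. Suc (k + N))"
  have h: "inj h" by (auto simp: h_def inj_on_def)
  have "m \<in> range h" if "m \<in> S - {1}" for m
  proof -
    have "m \<noteq> 1" using that by auto
    then obtain q where q: "prime q" "q dvd m" using prime_factor_nat by blast
    have "q \<notin> primes_le N" using that q by (auto simp: S_def)
    hence "q > N" using q by (auto simp: primes_le_def)
    moreover have "q \<le> m" using q that by (auto simp: S_def intro: dvd_imp_le)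
    ultimately show ?thesis by (intro image_eqI[of _ _ "m - Suc N"]) (auto simp: h_def)
  qed
  hence sub: "S - {1} \<subseteq> range h" by blast
  have 1: "1 \<in> S" by (auto simp: S_def primes_le_def)
  have "infsum f S = infsum f {1} + infsum f (S - {1})"
    using 1 infsum_Un_disjoint[of f "{1}" "S - {1}"] abs_summable_summable[OF abs] by (simp add: insert_absorb)
  moreover have "f 1 = 1" using dchars_1[OF \<xi>] by (simp add: f_def)
  moreover have "(\<Prod>q\<in>primes_le N. 1 - \<xi> q * of_nat q powr (-s)) * dirichlet_L \<xi> s = infsum f S"
    unfolding f_def S_def by (rule euler_product_finite[OF n \<xi> s']) (simp_all add: primes_le_def)
  ultimately have "(\<Prod>q\<in>primes_le N. 1 - \<xi> q * of_nat q powr (-s)) * dirichlet_L \<xi> s - 1 = infsum f (S - {1})"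
    by simp
  also have "norm \<dots> \<le> infsum (\<lambda>m. norm (f m)) (S - {1})"
    by (rule norm_infsum_bound[OF abs])
  also have "\<dots> \<le> infsum (\<lambda>m. norm (f m)) (range h)"
    using sub by (intro infsum_mono_neutral abs) auto
  also have "\<dots> = infsum ((\<lambda>m. norm (f m)) \<circ> h) UNIV"
    by (rule infsum_reindex[OF h])
  also have "\<dots> = (\<Sum>k. norm (f (h k)))"
  proof -
    have "(\<lambda>m. norm (f m)) \<circ> h summable_on UNIV"
      using abs summable_on_reindex[OF h] by blast
    hence "((\<lambda>m. norm (f m)) \<circ> h has_sum infsum ((\<lambda>m. norm (f m)) \<circ> h) UNIV) UNIV" by simp
    from has_sum_imp_sums[OF this] show ?thesis by (simp add: sums_iff o_def)
  qed
  also have "\<dots> \<le> (\<Sum>k. real (Suc (k + N)) powr (- \<sigma>))"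
  proof (rule suminf_le)
    fix k
    have "norm (f (h k)) \<le> real (h k) powr (- Re s)"
      using norm_dchars_le_1[OF \<xi> n, of "h k"]
      by (auto simp: f_def norm_mult norm_of_nat_powr h_def mult_left_le_one_le simp del: of_nat_Suc of_nat_add)
    also have "\<dots> \<le> real (h k) powr (- \<sigma>)" using s by (intro powr_mono) (auto simp: h_def)
    finally show *: "norm (f (h k)) \<le> real (Suc (k + N)) powr (- \<sigma>)" by (simp add: h_def)
  next
    show sm: "summable (\<lambda>k. real (Suc (k + N)) powr (- \<sigma>))"
      using summable_Suc_powr[OF \<sigma>] summable_iff_shift[of "\<lambda>k. real (Suc k) powr (-\<sigma>)" N] by blast
    have "(\<lambda>m. norm (f m)) \<circ> h summable_on UNIV"
      using abs summable_on_reindex[OF h] by blast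
    thus "summable (\<lambda>k. norm (f (h k)))" by (auto simp: summable_on_UNIV_nonneg_real_iff o_def)
  qed
  finally show ?thesis .
qed

lemma uniform_limit_euler_product:
  assumes n: "n > 0" and \<xi>: "\<xi> \<in> dchars n" and \<sigma>: "\<sigma> > 1"
  shows "uniform_limit {s. Re s \<ge> \<sigma>}
           (\<lambda>N s. (\<Prod>q\<in>primes_le N. 1 - \<xi> q * of_nat q powr (-s)) * dirichlet_L \<xi> s) (\<lambda>_. 1) sequentially"
proof (rule uniform_limitI)
  fix e :: real assume e: "e > 0"
  have "(\<lambda>N. \<Sum>k. real (Suc (k + N)) powr (- \<sigma>)) \<longlonglongrightarrow> 0"
    by (rule suminf_exist_split2[OF summable_Suc_powr[OF \<sigma>]])
  hence "\<forall>\<^sub>F N in sequentially. (\<Sum>k. real (Suc (k + N)) powr (- \<sigma>)) < e"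
    using e order_tendstoD(2) by blast
  thus "\<forall>\<^sub>F N in sequentially. \<forall>s\<in>{s. Re s \<ge> \<sigma>}.
      dist ((\<Prod>q\<in>primes_le N. 1 - \<xi> q * of_nat q powr (-s)) * dirichlet_L \<xi> s) 1 < e"
    by eventually_elim (auto simp: dist_norm intro: le_less_trans[OF euler_product_error[OF n \<xi> \<sigma>]])
qed

text \<open>A zero would make every sieved product 0, although these products tend to 1.\<close>

lemma dirichlet_L_nonzero:
  assumes n: "n > 0" and \<xi>: "\<xi> \<in> dchars n" and s: "Re s > 1"
  shows "dirichlet_L \<xi> s \<noteq> 0"
proof
  assume *: "dirichlet_L \<xi> s = 0"
  have "(\<lambda>N. (\<Prod>q\<in>primes_le N. 1 - \<xi> q * of_nat q powr (-s)) * dirichlet_L \<xi> s) \<longlonglongrightarrow> 1"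
    using tendsto_uniform_limitI[OF uniform_limit_euler_product[OF n \<xi> s], of s] by simp
  hence "(\<lambda>N::nat. 0 :: complex) \<longlonglongrightarrow> 1" by (simp only: * mult_zero_right)
  thus False using LIMSEQ_unique[OF tendsto_const] by (metis zero_neq_one)
qed

lemma norm_dirichlet_L_le:
  assumes "\<And>a. norm (\<xi> a) \<le> 1" "\<sigma> > 1" "Re s \<ge> \<sigma>"
  shows "norm (dirichlet_L \<xi> s) \<le> (\<Sum>m. real (Suc m) powr (- \<sigma>))"
proof -
  have *: "norm (\<xi> (Suc m) * of_nat (Suc m) powr (-s)) \<le> real (Suc m) powr (- \<sigma>)" for m
  proof -
    have "norm (\<xi> (Suc m) * of_nat (Suc m) powr (-s)) \<le> real (Suc m) powr (- Re s)"
      using assms(1)[of "Suc m"] by (simp add: norm_mult norm_of_nat_powr mult_left_le_one_le del: of_nat_Suc)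
    also have "\<dots> \<le> real (Suc m) powr (- \<sigma>)" using assms by (intro powr_mono) auto
    finally show ?thesis .
  qed
  show ?thesis unfolding dirichlet_L_def
    by (intro norm_suminf_le summable_Suc_powr * assms)
qed

section \<open>The product over all characters\<close>

definition dirichlet_prod :: "nat \<Rightarrow> complex \<Rightarrow> complex" where
  "dirichlet_prod n s = (\<Prod>\<xi>\<in>dchars n. dirichlet_L \<xi> s)"

definition euler_factor :: "nat \<Rightarrow> nat \<Rightarrow> complex \<Rightarrow> complex" where
  "euler_factor n q s = (\<Prod>\<xi>\<in>dchars n. inverse (1 - \<xi> q * of_nat q powr (-s)))"

lemma uniform_limit_prod_const1:
  fixes f :: "'i \<Rightarrow> 'a \<Rightarrow> 'b \<Rightarrow> complex"
  assumes "finite I" "\<And>i. i \<in> I \<Longrightarrow> uniform_limit S (f i) (\<lambda>_. 1) F"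
  shows "uniform_limit S (\<lambda>x y. \<Prod>i\<in>I. f i x y) (\<lambda>_. 1) F"
  using assms
proof (induction I rule: finite_induct)
  case (insert i I)
  have "uniform_limit S (\<lambda>x y. f i x y * (\<Prod>i\<in>I. f i x y)) (\<lambda>a. 1 * 1) F"
    by (intro uniform_lim_mult insert.IH insert.prems) (auto simp: bounded_iff insert.prems intro!: exI[of _ 1])
  thus ?case using insert.hyps by simp
qed (simp add: uniform_limit_const)

text \<open>The finite product of Euler factors equals \<open>dirichlet_prod n s / P N s\<close>,
  where \<open>P N\<close> tends uniformly to 1. Since \<open>dirichlet_prod n\<close> is bounded on
  the half-plane, the quotients converge uniformly.\<close>

lemma uniform_limit_euler_factors:
  assumes n: "n > 0" and \<sigma>: "\<sigma> > 1"
  shows "uniform_limit {s. Re s \<ge> \<sigma>} (\<lambda>N s. \<Prod>q\<in>primes_le N. euler_factor n q s) (dirichlet_prod n) sequentially"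
proof -
  define P where "P = (\<lambda>N s. \<Prod>\<xi>\<in>dchars n. (\<Prod>q\<in>primes_le N. 1 - \<xi> q * of_nat q powr (-s)) * dirichlet_L \<xi> s)"
  have P: "uniform_limit {s. Re s \<ge> \<sigma>} P (\<lambda>_. 1) sequentially"
    unfolding P_def
    by (intro uniform_limit_prod_const1 finite_dchars uniform_limit_euler_product[of n]) (use n \<sigma> in auto)
  have "norm (dirichlet_prod n s) \<le> (\<Prod>\<xi>\<in>dchars n. (\<Sum>m. real (Suc m) powr (- \<sigma>)))" if "Re s \<ge> \<sigma>" for s
    unfolding dirichlet_prod_def
    by (rule order.trans[OF norm_prod_le prod_mono]) (use norm_dirichlet_L_le[OF _ \<sigma> that] norm_dchars_le_1[OF _ n] n in auto)
  hence bdd: "bounded (dirichlet_prod n ` {s. Re s \<ge> \<sigma>})" unfolding bounded_iff by blast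
  have "uniform_limit {s. Re s \<ge> \<sigma>} (\<lambda>N s. dirichlet_prod n s / P N s) (\<lambda>s. dirichlet_prod n s / 1) sequentially"
    by (rule uniform_lim_divide[OF uniform_limit_const P bdd, where b = 1]) auto
  moreover have "dirichlet_prod n s / P N s = (\<Prod>q\<in>primes_le N. euler_factor n q s)" if "Re s \<ge> \<sigma>" for s N
  proof -
    have nz: "dirichlet_prod n s \<noteq> 0"
      using dirichlet_L_nonzero[OF n] that \<sigma> finite_dchars[OF n] by (auto simp: dirichlet_prod_def)
    have "P N s = (\<Prod>\<xi>\<in>dchars n. \<Prod>q\<in>primes_le N. 1 - \<xi> q * of_nat q powr (-s)) * dirichlet_prod n s"
      by (simp add: P_def prod.distrib dirichlet_prod_def)
    hence "dirichlet_prod n s / P N s = inverse (\<Prod>\<xi>\<in>dchars n. \<Prod>q\<in>primes_le N. 1 - \<xi> q * of_nat q powr (-s))"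
      using nz by (simp add: field_simps)
    also have "\<dots> = (\<Prod>q\<in>primes_le N. euler_factor n q s)"
      unfolding euler_factor_def by (subst prod.swap) (simp add: prod_inversef[symmetric] o_def)
    finally show ?thesis .
  qed
  ultimately show ?thesis
    by (subst (asm) uniform_limit_cong'[where g = "\<lambda>N s. \<Prod>q\<in>primes_le N. euler_factor n q s" and i = "dirichlet_prod n"]) auto
qed

text \<open>A first-order bound for -ln |1 - z|. The linear term is kept exact, so that summation
  over characters can apply orthogonality to it.\<close>

lemma norm_inverse_one_minus_le:
  fixes z :: complex
  assumes "norm z \<le> 1 / 2"
  shows "norm (inverse (1 - z)) \<le> exp (Re z + 12 * (norm z)\<^sup>2)"
proof -
  define u where "u = 2 * Re z - (norm z)\<^sup>2"
  have eq: "(norm (1 - z))\<^sup>2 = 1 - u"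
    unfolding u_def cmod_power2 by (simp add: power2_eq_square algebra_simps)
  have "norm (1 - z) \<ge> 1 / 2" using norm_triangle_ineq2[of 1 z] assms by simp
  hence "(norm (1 - z))\<^sup>2 \<ge> (1 / 2)\<^sup>2" by (intro power_mono) auto
  hence u: "1 - u \<ge> 1 / 4" unfolding eq by (simp add: power2_eq_square)
  have "(norm z)\<^sup>2 \<le> norm z * (1 / 2)" using mult_left_mono[OF assms, of "norm z"] by (simp add: power2_eq_square)
  moreover have "\<bar>Re z\<bar> \<le> norm z" by (rule abs_Re_le_cmod)
  moreover have "(norm z)\<^sup>2 \<ge> 0" by simp
  ultimately have "\<bar>u\<bar> \<le> 5 / 2 * norm z" unfolding u_def by linarith
  hence "\<bar>u\<bar>\<^sup>2 \<le> (5 / 2 * norm z)\<^sup>2" by (intro power_mono) auto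
  hence u2: "u\<^sup>2 \<le> 25 / 4 * (norm z)\<^sup>2" by (simp add: power_mult_distrib power2_eq_square)
  have "- ln (1 - u) \<le> 1 / (1 - u) - 1"
    using ln_le_minus_one[of "1 / (1 - u)"] u by (simp add: ln_div)
  also have "\<dots> = u + u\<^sup>2 / (1 - u)" using u by (simp add: field_simps power2_eq_square)
  also have "u\<^sup>2 / (1 - u) \<le> u\<^sup>2 / (1 / 4)" using u by (intro divide_left_mono) auto
  \<comment> \<open>Source of the 12: the square term contributes 4 * 25/4 = 25 times |z|^2,
    \<open>u\<close> itself contributes -1, and halving 24 gives 12.\<close>
  also have "u + u\<^sup>2 / (1 / 4) \<le> 2 * (Re z + 12 * (norm z)\<^sup>2)" using u2 unfolding u_def by simp
  finally have "- ln (1 - u) \<le> 2 * (Re z + 12 * (norm z)\<^sup>2)" by simp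
  moreover have "ln ((norm (1 - z))\<^sup>2) = 2 * ln (norm (1 - z))"
    using \<open>norm (1 - z) \<ge> 1 / 2\<close> by (simp add: ln_realpow)
  ultimately have "- ln (norm (1 - z)) \<le> Re z + 12 * (norm z)\<^sup>2" unfolding eq[symmetric] by simp
  hence "exp (- ln (norm (1 - z))) \<le> exp (Re z + 12 * (norm z)\<^sup>2)" by simp
  moreover have "exp (- ln (norm (1 - z))) = norm (inverse (1 - z))"
    using \<open>norm (1 - z) \<ge> 1 / 2\<close> by (subst exp_minus, subst exp_ln) (auto simp: norm_inverse)
  ultimately show ?thesis by simp
qed

text \<open>The nondegeneracy behind the orthogonality relation for sums over characters. It is
  invoked for modulus 1 and for prime powers with exponent at least 3.\<close>

definition chars_separate :: "nat \<Rightarrow> bool" where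
  "chars_separate n \<longleftrightarrow> (\<forall>a. coprime a n \<longrightarrow> \<not> [a = 1] (mod n) \<longrightarrow> (\<exists>\<psi>\<in>dchars n. \<psi> a \<noteq> 1))"

lemma sum_dchars:
  assumes "n > 0" "chars_separate n"
  shows "(\<Sum>\<xi>\<in>dchars n. \<xi> a) = of_nat (if [a = 1] (mod n) then card (dchars n) else 0)"
proof (cases "[a = 1] (mod n)")
  case True
  thus ?thesis using sum_dchars_eq_card by simp
next
  case False
  show ?thesis
  proof (cases "coprime a n")
    case True
    then obtain \<psi> where "\<psi> \<in> dchars n" "\<psi> a \<noteq> 1"
      using assms(2) False by (auto simp: chars_separate_def)
    from sum_dchars_eq_0[OF assms(1) this] False show ?thesis by simp
  next
    case ncop: False
    have "(\<Sum>\<xi>\<in>dchars n. \<xi> a) = 0"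
      using ncop by (intro sum.neutral) (auto simp: dchars_eq_0_iff)
    thus ?thesis using False by simp
  qed
qed

text \<open>The linear terms of the bound add up to the real part of a character sum, which
  orthogonality evaluates; the quadratic terms are at most a multiple of
  \<open>1 / real q ^ 2\<close>.\<close>

lemma norm_euler_factor_le:
  assumes n: "n > 0" and sep: "chars_separate n" and q: "prime q" and x: "x > 1"
  shows "norm (euler_factor n q (of_real x)) \<le>
           exp (real (card (dchars n)) * ((if [q = 1] (mod n) then 1 / real q else 0) + 12 * (1 / real q ^ 2)))"
proof -
  define y where "y = real q powr (-x)"
  have q2: "real q \<ge> 2" using prime_ge_2_nat[OF q] by simp
  have "y \<le> real q powr (-1)" unfolding y_def using x q2 by (intro powr_mono) auto
  hence y: "0 \<le> y" "y \<le> 1 / real q" using q2 by (auto simp: y_def powr_minus_divide)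
  have y2: "y \<le> 1 / 2" using y(2) q2 by (smt (verit) divide_left_mono divide_nonneg_nonneg zero_less_mult_iff)
  have yp: "of_nat q powr (- of_real x) = (of_real y :: complex)"
    using powr_of_real[of "real q" "-x"] q2 by (simp add: y_def)
  have nb: "norm (\<xi> q * of_real y) \<le> y" if "\<xi> \<in> dchars n" for \<xi>
    using norm_dchars_le_1[OF that n, of q] y by (simp add: norm_mult mult_left_le_one_le)
  have "norm (euler_factor n q (of_real x)) = (\<Prod>\<xi>\<in>dchars n. norm (inverse (1 - \<xi> q * of_real y)))"
    unfolding euler_factor_def yp by (simp add: prod_norm)
  also have "\<dots> \<le> (\<Prod>\<xi>\<in>dchars n. exp (Re (\<xi> q * of_real y) + 12 * (1 / real q ^ 2)))"
  proof (intro prod_mono conjI norm_ge_zero)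
    fix \<xi> assume \<xi>: "\<xi> \<in> dchars n"
    have "norm (inverse (1 - \<xi> q * of_real y)) \<le> exp (Re (\<xi> q * of_real y) + 12 * (norm (\<xi> q * of_real y))\<^sup>2)"
      using nb[OF \<xi>] y2 by (intro norm_inverse_one_minus_le) linarith
    also have "(norm (\<xi> q * of_real y))\<^sup>2 \<le> (1 / real q)\<^sup>2"
      using nb[OF \<xi>] y(2) by (intro power_mono) auto
    finally show "norm (inverse (1 - \<xi> q * of_real y)) \<le> exp (Re (\<xi> q * of_real y) + 12 * (1 / real q ^ 2))"
      by (simp add: power_one_over)
  qed
  also have "\<dots> = exp (y * Re (\<Sum>\<xi>\<in>dchars n. \<xi> q) + real (card (dchars n)) * (12 * (1 / real q ^ 2)))"
    by (simp add: exp_sum[symmetric] finite_dchars[OF n] sum.distrib sum_distrib_left Re_sum mult_ac)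
  also have "\<dots> \<le> exp (real (card (dchars n)) * ((if [q = 1] (mod n) then 1 / real q else 0) + 12 * (1 / real q ^ 2)))"
    using mult_right_mono[OF y(2), of "real (card (dchars n))"]
    by (simp add: sum_dchars[OF n sep] algebra_simps)
  finally show ?thesis .
qed

text \<open>The sum of \<open>1 / real q ^ 2\<close> over primes converges, so a bound on the
  reciprocals of the primes congruent to 1 bounds all finite products, uniformly in
  \<open>x > 1\<close>.\<close>

lemma dirichlet_prod_bounded:
  assumes n: "n > 0" and sep: "chars_separate n"
    and B: "\<And>N. (\<Sum>q\<in>primes_le N. if [q = 1] (mod n) then 1 / real q else 0) \<le> B"
  shows "\<exists>M. \<forall>x>1. norm (dirichlet_prod n (of_real x)) \<le> M"
proof -
  define c where "c = real (card (dchars n))"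
  define D where "D = (\<Sum>k. 1 / real k ^ 2)"
  have D: "(\<Sum>q\<in>primes_le N. 1 / real q ^ 2) \<le> D" for N
    unfolding D_def using inverse_power_summable[of 2, where 'a = real]
    by (intro sum_le_suminf) (auto simp: inverse_eq_divide)
  have "norm (dirichlet_prod n (of_real x)) \<le> exp (c * (B + 12 * D))" if x: "x > 1" for x :: real
  proof (rule tendsto_upperbound)
    have "(\<lambda>N. \<Prod>q\<in>primes_le N. euler_factor n q (of_real x)) \<longlonglongrightarrow> dirichlet_prod n (of_real x)"
      using tendsto_uniform_limitI[OF uniform_limit_euler_factors[OF n x], of "of_real x"] by simp
    thus "(\<lambda>N. norm (\<Prod>q\<in>primes_le N. euler_factor n q (of_real x))) \<longlonglongrightarrow> norm (dirichlet_prod n (of_real x))"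
      by (rule tendsto_norm)
    have "norm (\<Prod>q\<in>primes_le N. euler_factor n q (of_real x)) \<le> exp (c * (B + 12 * D))" for N
    proof -
      have "norm (\<Prod>q\<in>primes_le N. euler_factor n q (of_real x)) \<le>
          (\<Prod>q\<in>primes_le N. exp (c * ((if [q = 1] (mod n) then 1 / real q else 0) + 12 * (1 / real q ^ 2))))"
        unfolding prod_norm[symmetric] c_def
        by (intro prod_mono conjI norm_ge_zero norm_euler_factor_le n sep x) (auto simp: primes_le_def)
      also have "\<dots> = exp (c * ((\<Sum>q\<in>primes_le N. if [q = 1] (mod n) then 1 / real q else 0) +
                                12 * (\<Sum>q\<in>primes_le N. 1 / real q ^ 2)))"
        by (simp only: exp_sum[OF finite_primes_le, symmetric] sum_distrib_left[symmetric] sum.distrib)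
      also have "\<dots> \<le> exp (c * (B + 12 * D))"
        using B[of N] D[of N] by (intro iffD2[OF exp_le_cancel_iff] mult_left_mono) (auto simp: c_def)
      finally show ?thesis .
    qed
    thus "\<forall>\<^sub>F N in sequentially. norm (\<Prod>q\<in>primes_le N. euler_factor n q (of_real x)) \<le> exp (c * (B + 12 * D))"
      by simp
  qed auto
  thus ?thesis by blast
qed

section \<open>Holomorphic extension of the product of L-series\<close>

text \<open>Induction on \<open>c\<close>: the growth bound on the segment to the right of
  \<open>a\<close> forces \<open>f a = 0\<close> by continuity, and dividing by z - a lowers the
  exponent by one.\<close>

lemma holomorphic_factor_power:
  fixes f :: "complex \<Rightarrow> complex"
  assumes "f holomorphic_on S" "open S" "a \<in> S"
    and "\<And>t. 0 < t \<Longrightarrow> t \<le> 1 \<Longrightarrow> norm (f (a + of_real t)) \<le> M * t ^ c"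
  shows "\<exists>g. g holomorphic_on S \<and> (\<forall>z\<in>S. f z = (z - a) ^ c * g z)"
  using assms
proof (induction c arbitrary: f)
  case 0
  thus ?case by (auto intro!: exI[of _ f])
next
  case (Suc c)
  define g where "g = (\<lambda>z. if z = a then deriv f a else (f z - f a) / (z - a))"
  have g: "g holomorphic_on S"
    unfolding g_def using Suc.prems by (intro pole_lemma) (auto simp: interior_open)
  have "f a = 0"
  proof -
    have "isCont f a" using Suc.prems continuous_on_eq_continuous_at holomorphic_on_imp_continuous_on by blast
    moreover have "((\<lambda>t. a + of_real t) \<longlongrightarrow> a + of_real 0) (at_right (0::real))"
      by (intro tendsto_intros)
    ultimately have "((\<lambda>t. f (a + of_real t)) \<longlongrightarrow> f a) (at_right (0::real))"
      using isCont_tendsto_compose by fastforce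
    hence lim1: "((\<lambda>t. norm (f (a + of_real t))) \<longlongrightarrow> norm (f a)) (at_right (0::real))"
      by (rule tendsto_norm)
    have lim2: "((\<lambda>t. M * t ^ Suc c) \<longlongrightarrow> M * 0 ^ Suc c) (at_right (0::real))"
      by (intro tendsto_intros)
    have "eventually (\<lambda>t. norm (f (a + of_real t)) \<le> M * t ^ Suc c) (at_right (0::real))"
      unfolding eventually_at_right_field using Suc.prems(4) by (intro exI[of _ 1]) auto
    from tendsto_le[OF trivial_limit_at_right_real lim2 lim1 this]
    have "norm (f a) \<le> M * 0 ^ Suc c" .
    thus ?thesis by simp
  qed
  hence fg: "f z = (z - a) * g z" for z by (auto simp: g_def)
  have "norm (g (a + of_real t)) \<le> M * t ^ c" if t: "0 < t" "t \<le> 1" for t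
  proof -
    have "t * norm (g (a + of_real t)) = norm (f (a + of_real t))"
      using t by (simp add: fg norm_mult)
    also have "\<dots> \<le> t * (M * t ^ c)" using Suc.prems(4)[OF t] by (simp add: mult_ac)
    finally show ?thesis using t by simp
  qed
  from Suc.IH[OF g Suc.prems(2,3) this] obtain h where
    "h holomorphic_on S" "\<forall>z\<in>S. g z = (z - a) ^ c * h z" by blast
  thus ?case using fg by (intro exI[of _ h]) (simp add: mult_ac)
qed

text \<open>The product \<open>K\<close> of all (s - 1) L(s, \<xi>) is holomorphic for
  \<open>Re s > 0\<close>. Boundedness of the product of L-series to the right of 1 gives
  \<open>K\<close> a zero of order at least \<open>card (dchars n)\<close> at 1, and dividing it out
  leaves the extension.\<close>

lemma dirichlet_prod_extends:
  assumes n: "n > 0" and sep: "chars_separate n"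
    and B: "\<And>N. (\<Sum>q\<in>primes_le N. if [q = 1] (mod n) then 1 / real q else 0) \<le> B"
  obtains G where "G holomorphic_on {s. Re s > 0}"
    "\<And>s. Re s > 1 \<Longrightarrow> G s = dirichlet_prod n s"
    "\<And>s. Re s > 0 \<Longrightarrow> (\<Prod>\<xi>\<in>dchars n. dirichlet_L_ext n \<xi> s) = (s - 1) ^ card (dchars n) * G s"
proof -
  define K where "K = (\<lambda>s. \<Prod>\<xi>\<in>dchars n. dirichlet_L_ext n \<xi> s)"
  have K: "K holomorphic_on {s. Re s > 0}"
    unfolding K_def by (intro holomorphic_intros holomorphic_dirichlet_L_ext n)
  have K_eq: "K s = (s - 1) ^ card (dchars n) * dirichlet_prod n s" if "Re s > 1" for s
  proof -
    have "K s = (\<Prod>\<xi>\<in>dchars n. (s - 1) * dirichlet_L \<xi> s)" unfolding K_def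
      using dchars_cong norm_dchars_le_1[OF _ n] n that by (intro prod.cong dirichlet_L_ext_eq) auto
    thus ?thesis by (simp add: prod.distrib dirichlet_prod_def)
  qed
  obtain M where M: "norm (dirichlet_prod n (of_real x)) \<le> M" if "x > 1" for x
    using dirichlet_prod_bounded[OF n sep B] by blast
  have "norm (K (1 + of_real t)) \<le> M * t ^ card (dchars n)" if "0 < t" "t \<le> 1" for t
    using M[of "1 + t"] that by (simp add: K_eq norm_mult norm_power mult_left_mono mult.commute)
  then obtain G where G: "G holomorphic_on {s. Re s > 0}"
      "\<forall>s\<in>{s. Re s > 0}. K s = (s - 1) ^ card (dchars n) * G s"
    using holomorphic_factor_power[OF K, of 1 M "card (dchars n)"] by (auto simp: open_halfspace_Re_gt)
  show thesis
  proof (rule that[OF G(1)])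
    show "G s = dirichlet_prod n s" if "Re s > 1" for s
      using K_eq[OF that] G(2) that by auto
    show "(\<Prod>\<xi>\<in>dchars n. dirichlet_L_ext n \<xi> s) = (s - 1) ^ card (dchars n) * G s" if "Re s > 0" for s
      using G(2) that by (simp add: K_def)
  qed
qed

text \<open>For modulus 1 the extension would force (s - 1) \<zeta>(s) to vanish at s = 1, where its
  value is 1.\<close>

lemma prime_reciprocals_unbounded: "\<exists>N. (\<Sum>q\<in>primes_le N. 1 / real q) > B"
proof (rule ccontr)
  assume "\<not> ?thesis"
  hence B: "(\<Sum>q\<in>primes_le N. if [q = 1] (mod 1) then 1 / real q else 0) \<le> B" for N
    by (simp add: not_less cong_def)
  have sep: "chars_separate 1" by (simp add: chars_separate_def cong_def)
  obtain G where "(\<Prod>\<xi>\<in>dchars 1. dirichlet_L_ext 1 \<xi> 1) = (1 - 1) ^ card (dchars 1) * G (1::complex)"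
    using dirichlet_prod_extends[OF _ sep B] by (metis one_complex.simps(1) zero_less_one)
  moreover have "card (dchars 1) \<noteq> 0"
    using dchars_principal[of 1] finite_dchars[of 1] by auto
  moreover have "dirichlet_L_ext 1 \<xi> 1 = 1" if "\<xi> \<in> dchars 1" for \<xi>
    using dchars_1[OF that] by (simp add: dirichlet_L_ext_def hurwitz_ext_at_1)
  ultimately show False by (simp add: power_0_left)
qed

section \<open>Functions with nonnegative Taylor coefficients\<close>

text \<open>Nonnegative Taylor coefficients at 0. The main use is in the variable w = 2 - s, so that
  moving right from w = 0 moves s left from 2.\<close>

definition nonneg_derivs :: "(complex \<Rightarrow> complex) \<Rightarrow> bool" where
  "nonneg_derivs f \<longleftrightarrow> (\<forall>k. (deriv ^^ k) f 0 \<in> \<real>\<^sub>\<ge>\<^sub>0)"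

lemma nonneg_Reals_sum: "(\<And>i. i \<in> I \<Longrightarrow> f i \<in> \<real>\<^sub>\<ge>\<^sub>0) \<Longrightarrow> sum f I \<in> \<real>\<^sub>\<ge>\<^sub>0"
  for f :: "'a \<Rightarrow> complex"
  by (induction I rule: infinite_finite_induct) auto

lemma nonneg_derivs_const: "c \<in> \<real>\<^sub>\<ge>\<^sub>0 \<Longrightarrow> nonneg_derivs (\<lambda>_. c)"
  by (auto simp: nonneg_derivs_def)

lemma nonneg_derivs_add:
  assumes "f holomorphic_on ball 0 r" "g holomorphic_on ball 0 r" "r > 0" "nonneg_derivs f" "nonneg_derivs g"
  shows "nonneg_derivs (\<lambda>w. f w + g w)"
  unfolding nonneg_derivs_def
proof
  fix k
  have "(deriv ^^ k) (\<lambda>w. f w + g w) 0 = (deriv ^^ k) f 0 + (deriv ^^ k) g 0"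
    using assms(3) by (intro higher_deriv_add[OF assms(1,2)]) auto
  thus "(deriv ^^ k) (\<lambda>w. f w + g w) 0 \<in> \<real>\<^sub>\<ge>\<^sub>0" using assms(4,5) by (simp add: nonneg_derivs_def)
qed

lemma nonneg_derivs_mult:
  assumes "f holomorphic_on ball 0 r" "g holomorphic_on ball 0 r" "r > 0" "nonneg_derivs f" "nonneg_derivs g"
  shows "nonneg_derivs (\<lambda>w. f w * g w)"
  unfolding nonneg_derivs_def
proof
  fix k
  have "(deriv ^^ k) (\<lambda>w. f w * g w) 0 =
          (\<Sum>i = 0..k. of_nat (k choose i) * (deriv ^^ i) f 0 * (deriv ^^ (k - i)) g 0)"
    using assms(3) by (intro higher_deriv_mult[OF assms(1,2)]) auto
  also have "\<dots> \<in> \<real>\<^sub>\<ge>\<^sub>0" using assms(4,5) by (intro nonneg_Reals_sum) (simp add: nonneg_derivs_def)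
  finally show "(deriv ^^ k) (\<lambda>w. f w * g w) 0 \<in> \<real>\<^sub>\<ge>\<^sub>0" .
qed

lemma nonneg_derivs_prod:
  assumes "r > 0" "\<And>i. i \<in> I \<Longrightarrow> f i holomorphic_on ball 0 r" "\<And>i. i \<in> I \<Longrightarrow> nonneg_derivs (f i)"
  shows "nonneg_derivs (\<lambda>w. \<Prod>i\<in>I. f i w)"
  using assms(2,3)
proof (induction I rule: infinite_finite_induct)
  case (insert i I)
  have "nonneg_derivs (\<lambda>w. f i w * (\<Prod>i\<in>I. f i w))"
    using insert by (intro nonneg_derivs_mult[OF _ _ assms(1)] holomorphic_intros) auto
  thus ?case using insert.hyps by simp
qed (auto intro: nonneg_derivs_const)

text \<open>Derivatives at 0 pass to uniform limits of holomorphic functions, and the nonnegative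
  reals form a closed set.\<close>

lemma nonneg_derivs_limit:
  assumes "uniform_limit (ball 0 r) f g sequentially" "\<And>N. f N holomorphic_on ball 0 r" "r > 0"
    and "eventually (\<lambda>N. nonneg_derivs (f N)) sequentially"
  shows "nonneg_derivs g"
  unfolding nonneg_derivs_def
proof
  fix k
  have lim: "(\<lambda>N. (deriv ^^ k) (f N) 0) \<longlonglongrightarrow> (deriv ^^ k) g 0"
    using assms by (intro higher_deriv_complex_uniform_limit[OF assms(1)]) auto
  have "eventually (\<lambda>N. (deriv ^^ k) (f N) 0 \<in> \<real>\<^sub>\<ge>\<^sub>0) sequentially"
    using assms(4) by eventually_elim (auto simp: nonneg_derivs_def)
  from Lim_in_closed_set[OF closed_nonneg_Reals_complex this trivial_limit_sequentially lim]
  show "(deriv ^^ k) g 0 \<in> \<real>\<^sub>\<ge>\<^sub>0" .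
qed

lemma higher_deriv_exp_linear: "(deriv ^^ k) (\<lambda>w. exp (b * w)) = (\<lambda>w::complex. b ^ k * exp (b * w))"
proof (induction k)
  case (Suc k)
  have "deriv (\<lambda>w. b ^ k * exp (b * w)) w = b ^ Suc k * exp (b * w)" for w
    by (rule DERIV_imp_deriv) (auto intro!: derivative_eq_intros)
  thus ?case using Suc by auto
qed auto

lemma nonneg_derivs_exp: "b \<in> \<real>\<^sub>\<ge>\<^sub>0 \<Longrightarrow> nonneg_derivs (\<lambda>w. exp (b * w))"
  by (simp add: nonneg_derivs_def higher_deriv_exp_linear)

text \<open>The transfer step of Landau's method: the Taylor series at 0 converges on the whole disc
  of holomorphy, so information at the centre gives positivity on the entire radius.\<close>

lemma nonneg_derivs_imp_nonneg:
  assumes "f holomorphic_on ball 0 r" "nonneg_derivs f" "0 \<le> x" "x < r"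
  shows "f (of_real x) \<in> \<real>\<^sub>\<ge>\<^sub>0"
proof -
  have "(\<lambda>k. (deriv ^^ k) f 0 / fact k * (of_real x - 0) ^ k) sums f (of_real x)"
    using assms by (intro holomorphic_power_series[OF assms(1)]) auto
  hence lim: "(\<lambda>N. \<Sum>k<N. (deriv ^^ k) f 0 / fact k * of_real x ^ k) \<longlonglongrightarrow> f (of_real x)"
    by (simp add: sums_def)
  have "(\<Sum>k<N. (deriv ^^ k) f 0 / fact k * of_real x ^ k) \<in> \<real>\<^sub>\<ge>\<^sub>0" for N
  proof (intro nonneg_Reals_sum nonneg_Reals_mult_I nonneg_Reals_divide_I nonneg_Reals_pow_I)
    show "fact k \<in> (\<real>\<^sub>\<ge>\<^sub>0 :: complex set)" for k
      using nonneg_Reals_of_nat_I[of "fact k", where 'a = complex] by simp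
  qed (use assms in \<open>auto simp: nonneg_derivs_def\<close>)
  from Lim_in_closed_set[OF closed_nonneg_Reals_complex always_eventually trivial_limit_sequentially lim] this
  show ?thesis by blast
qed

text \<open>Substituting \<open>u\<close> into the Taylor series of \<open>f\<close> gives sums of
  powers of \<open>u\<close> with nonnegative coefficients. The bound 1/2 stays away from the circle
  of radius 1, so they converge uniformly.\<close>

lemma nonneg_derivs_compose:
  assumes f: "f holomorphic_on ball 0 1" "nonneg_derivs f"
    and u: "u holomorphic_on ball 0 r" "nonneg_derivs u" "r > 0" "\<And>w. w \<in> ball 0 r \<Longrightarrow> norm (u w) \<le> 1 / 2"
  shows "nonneg_derivs (\<lambda>w. f (u w))"
proof -
  define a where "a = (\<lambda>k. (deriv ^^ k) f 0 / fact k)"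
  have a: "a k \<in> \<real>\<^sub>\<ge>\<^sub>0" for k
    using f(2) nonneg_Reals_of_nat_I[of "fact k", where 'a = complex] by (auto simp: a_def nonneg_derivs_def intro!: nonneg_Reals_divide_I)
  have sums: "(\<lambda>k. a k * z ^ k) sums f z" if "norm z < 1" for z
    using holomorphic_power_series[OF f(1), of z] that by (simp add: a_def)
  show ?thesis
  proof (rule nonneg_derivs_limit[OF _ _ u(3)])
    show "uniform_limit (ball 0 r) (\<lambda>N w. \<Sum>k<N. a k * u w ^ k) (\<lambda>w. f (u w)) sequentially"
    proof -
      have "uniform_limit (ball 0 r) (\<lambda>N w. \<Sum>k<N. a k * u w ^ k) (\<lambda>w. \<Sum>k. a k * u w ^ k) sequentially"
      proof (rule Weierstrass_m_test)
        \<comment> \<open>The point 3/4 lies strictly between 1/2 and 1: convergence there yields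
          absolute convergence at 1/2.\<close>
        have "summable (\<lambda>k. a k * (3 / 4) ^ k)" using sums[of "3/4"] by (auto simp: sums_iff)
        hence "summable (\<lambda>k. norm (a k * (1 / 2) ^ k))" by (rule powser_insidea) simp
        thus "summable (\<lambda>k. norm (a k) * (1 / 2) ^ k)" by (simp add: norm_mult norm_power norm_divide)
        show "norm (a k * u w ^ k) \<le> norm (a k) * (1 / 2) ^ k" if "w \<in> ball 0 r" for k w
          using u(4)[OF that] by (auto simp: norm_mult norm_power simp del: power_divide intro!: mult_left_mono power_mono)
      qed
      moreover have "(\<Sum>k. a k * u w ^ k) = f (u w)" if "w \<in> ball 0 r" for w
        using u(4)[OF that] sums[of "u w"] by (auto simp: sums_iff)
      ultimately show ?thesis
        by (subst (asm) uniform_limit_cong'[where i = "\<lambda>w. f (u w)"]) auto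
    qed
    show "(\<lambda>w. \<Sum>k<N. a k * u w ^ k) holomorphic_on ball 0 r" for N
      by (intro holomorphic_intros u)
    have pw: "nonneg_derivs (\<lambda>w. u w ^ k)" for k
      using nonneg_derivs_prod[of r "{..<k}" "\<lambda>_. u"] u by simp
    have "nonneg_derivs (\<lambda>w. \<Sum>k<N. a k * u w ^ k)" for N
    proof (induction N)
      case (Suc N)
      have "nonneg_derivs (\<lambda>w. (\<Sum>k<N. a k * u w ^ k) + a N * u w ^ N)"
        by (intro nonneg_derivs_add[OF _ _ u(3)] nonneg_derivs_mult[OF _ _ u(3)] Suc pw nonneg_derivs_const a holomorphic_intros u)
      thus ?case by simp
    qed (auto intro: nonneg_derivs_const)
    thus "\<forall>\<^sub>F N in sequentially. nonneg_derivs (\<lambda>w. \<Sum>k<N. a k * u w ^ k)" by simp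
  qed
qed

lemma nonneg_derivs_diff_prod:
  fixes f g :: "'i \<Rightarrow> complex \<Rightarrow> complex"
  assumes "r > 0" "finite I" "\<And>i. i \<in> I \<Longrightarrow> f i holomorphic_on ball 0 r" "\<And>i. i \<in> I \<Longrightarrow> g i holomorphic_on ball 0 r"
    and "\<And>i. i \<in> I \<Longrightarrow> nonneg_derivs (g i)" "\<And>i. i \<in> I \<Longrightarrow> nonneg_derivs (\<lambda>w. f i w - g i w)"
  shows "nonneg_derivs (\<lambda>w. (\<Prod>i\<in>I. f i w) - (\<Prod>i\<in>I. g i w))"
  using assms(2-)
proof (induction I rule: finite_induct)
  case empty
  thus ?case using nonneg_derivs_const[of 0] by simp
next
  case (insert i I)
  have pf: "nonneg_derivs (f j)" if "j \<in> insert i I" for j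
  proof -
    have "nonneg_derivs (\<lambda>w. (f j w - g j w) + g j w)"
      using that insert.prems by (intro nonneg_derivs_add[OF _ _ assms(1)] holomorphic_intros) auto
    thus ?thesis by simp
  qed
  \<comment> \<open>A difference of products, f F - g G, is (f - g) F + g (F - G).\<close>
  have "nonneg_derivs (\<lambda>w. (f i w - g i w) * (\<Prod>j\<in>I. f j w) + g i w * ((\<Prod>j\<in>I. f j w) - (\<Prod>j\<in>I. g j w)))"
    using insert pf by (intro nonneg_derivs_add[OF _ _ assms(1)] nonneg_derivs_mult[OF _ _ assms(1)] nonneg_derivs_prod[OF assms(1)] holomorphic_intros) auto
  thus ?case using insert.hyps by (simp add: algebra_simps)
qed

section \<open>Taylor coefficients of the local factors\<close>

text \<open>Stated on the whole disc, since the induction differentiates the previous formula near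
  \<open>w\<close>.\<close>

lemma higher_deriv_inverse_linear:
  fixes c w :: complex
  assumes "norm c \<le> 1" "norm w < 1"
  shows "(deriv ^^ k) (\<lambda>z. c * inverse (1 - c * z)) w = fact k * c ^ Suc k * inverse (1 - c * w) ^ Suc k"
  using assms(2)
proof (induction k arbitrary: w)
  case (Suc k)
  have nz: "1 - c * w \<noteq> 0"
  proof
    assume "1 - c * w = 0"
    hence "norm (c * w) = 1" by simp
    moreover have "norm (c * w) < 1"
      using assms(1) Suc.prems by (simp add: norm_mult mult_le_less_imp_less le_less_trans[OF mult_right_mono[of "norm c" 1 "norm w"]])
    ultimately show False by simp
  qed
  have "(deriv ^^ Suc k) (\<lambda>z. c * inverse (1 - c * z)) w = deriv (\<lambda>w. fact k * c ^ Suc k * inverse (1 - c * w) ^ Suc k) w"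
    unfolding funpow.simps o_def
    using Suc.prems eventually_nhds_in_open[of "ball 0 1" w]
    by (intro deriv_cong_ev) (auto elim!: eventually_mono simp: Suc.IH)
  also have "\<dots> = fact (Suc k) * c ^ Suc (Suc k) * inverse (1 - c * w) ^ Suc (Suc k)"
  proof (rule DERIV_imp_deriv)
    have "((\<lambda>w. inverse (1 - c * w)) has_field_derivative c * inverse (1 - c * w) ^ 2) (at w)"
      using nz by (auto intro!: derivative_eq_intros simp: power2_eq_square)
    from DERIV_cmult[OF DERIV_power[OF this, of "Suc k"], of "fact k * c ^ Suc k"]
    show "((\<lambda>w. fact k * c ^ Suc k * inverse (1 - c * w) ^ Suc k) has_field_derivative
        fact (Suc k) * c ^ Suc (Suc k) * inverse (1 - c * w) ^ Suc (Suc k)) (at w)"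
      by (simp add: algebra_simps power2_eq_square)
  qed
  finally show ?case .
qed auto

text \<open>The Euler factor at \<open>q\<close> as a function of z = q^(-s).\<close>

definition euler_local :: "nat \<Rightarrow> nat \<Rightarrow> complex \<Rightarrow> complex" where
  "euler_local n q z = (\<Prod>\<xi>\<in>dchars n. inverse (1 - \<xi> q * z))"

text \<open>The logarithmic derivative of \<open>euler_local n q\<close>. Unlike the product, its
  coefficients are plain character sums.\<close>

definition euler_logderiv :: "nat \<Rightarrow> nat \<Rightarrow> complex \<Rightarrow> complex" where
  "euler_logderiv n q z = (\<Sum>\<xi>\<in>dchars n. \<xi> q * inverse (1 - \<xi> q * z))"

lemma one_minus_dchars_nonzero:
  assumes "n > 0" "\<xi> \<in> dchars n" "norm z < 1"
  shows "1 - \<xi> q * z \<noteq> 0"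
proof
  assume "1 - \<xi> q * z = 0"
  hence "norm (\<xi> q) * norm z = 1" by (metis eq_iff_diff_eq_0 norm_mult norm_one)
  moreover have "norm (\<xi> q) * norm z \<le> 1 * norm z"
    by (intro mult_right_mono norm_dchars_le_1[OF assms(2,1)]) auto
  ultimately show False using assms(3) by simp
qed

lemma holomorphic_euler_local: "n > 0 \<Longrightarrow> euler_local n q holomorphic_on ball 0 1"
  unfolding euler_local_def[abs_def] using one_minus_dchars_nonzero by (intro holomorphic_intros) auto

lemma holomorphic_euler_logderiv: "n > 0 \<Longrightarrow> euler_logderiv n q holomorphic_on ball 0 1"
  unfolding euler_logderiv_def[abs_def] using one_minus_dchars_nonzero by (intro holomorphic_intros) auto

lemma deriv_euler_local:
  assumes n: "n > 0" and z: "norm z < 1"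
  shows "deriv (euler_local n q) z = euler_local n q z * euler_logderiv n q z"
proof -
  have "((\<lambda>z. \<Prod>\<xi>\<in>C. inverse (1 - \<xi> q * z)) has_field_derivative
          (\<Prod>\<xi>\<in>C. inverse (1 - \<xi> q * z)) * (\<Sum>\<xi>\<in>C. \<xi> q * inverse (1 - \<xi> q * z))) (at z)"
    if "finite C" "C \<subseteq> dchars n" for C
    using that
  proof (induction C rule: finite_induct)
    case (insert \<xi> C)
    have nz: "1 - \<xi> q * z \<noteq> 0" using one_minus_dchars_nonzero[OF n _ z] insert.prems by auto
    have "((\<lambda>w. inverse (1 - \<xi> q * w)) has_field_derivative inverse (1 - \<xi> q * z) * (\<xi> q * inverse (1 - \<xi> q * z))) (at z)"
      using nz by (auto intro!: derivative_eq_intros)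
    from DERIV_mult[OF this insert.IH] insert show ?case
      by (simp add: algebra_simps)
  qed auto
  thus ?thesis unfolding euler_local_def[abs_def] euler_logderiv_def
    by (intro DERIV_imp_deriv) (use finite_dchars[OF n] in auto)
qed

lemma higher_deriv_sum:
  fixes f :: "'i \<Rightarrow> complex \<Rightarrow> complex"
  assumes "\<And>i. i \<in> I \<Longrightarrow> f i holomorphic_on S" "open S" "z \<in> S"
  shows "(deriv ^^ k) (\<lambda>w. \<Sum>i\<in>I. f i w) z = (\<Sum>i\<in>I. (deriv ^^ k) (f i) z)"
  using assms(1)
proof (induction I rule: infinite_finite_induct)
  case (insert i I)
  have "(deriv ^^ k) (\<lambda>w. f i w + (\<Sum>i\<in>I. f i w)) z = (deriv ^^ k) (f i) z + (deriv ^^ k) (\<lambda>w. \<Sum>i\<in>I. f i w) z"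
    using insert by (intro higher_deriv_add[OF _ _ assms(2,3)] holomorphic_intros) auto
  thus ?case using insert by simp
qed auto

lemma higher_deriv_euler_logderiv:
  assumes n: "n > 0" and sep: "chars_separate n"
  shows "(deriv ^^ k) (euler_logderiv n q) 0 =
           of_nat (fact k * (if [q ^ Suc k = 1] (mod n) then card (dchars n) else 0))"
proof -
  have "(deriv ^^ k) (euler_logderiv n q) 0 = (\<Sum>\<xi>\<in>dchars n. (deriv ^^ k) (\<lambda>z. \<xi> q * inverse (1 - \<xi> q * z)) 0)"
    unfolding euler_logderiv_def[abs_def]
    using one_minus_dchars_nonzero[OF n] by (intro higher_deriv_sum[where S = "ball 0 1"] holomorphic_intros) auto
  also have "\<dots> = (\<Sum>\<xi>\<in>dchars n. fact k * \<xi> (q ^ Suc k))"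
    by (intro sum.cong refl, subst higher_deriv_inverse_linear)
       (auto simp: norm_dchars_le_1[OF _ n] dchars_power dchars_mult)
  also have "\<dots> = fact k * (\<Sum>\<xi>\<in>dchars n. \<xi> (q ^ Suc k))"
    by (simp only: sum_distrib_left)
  also have "\<dots> = of_nat (fact k * (if [q ^ Suc k = 1] (mod n) then card (dchars n) else 0))"
    unfolding sum_dchars[OF n sep] by simp
  finally show ?thesis .
qed

text \<open>Leibniz's rule applied to E' = E L, where L is the logarithmic derivative. This
  recursion for the coefficients of E replaces the use of a complex logarithm.\<close>

lemma higher_deriv_euler_local:
  assumes n: "n > 0"
  shows "(deriv ^^ Suc k) (euler_local n q) 0 =
     (\<Sum>i = 0..k. of_nat (k choose i) * (deriv ^^ i) (euler_local n q) 0 * (deriv ^^ (k - i)) (euler_logderiv n q) 0)"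
proof -
  have "(deriv ^^ Suc k) (euler_local n q) 0 = (deriv ^^ k) (deriv (euler_local n q)) 0"
    by (simp add: funpow_swap1)
  also have "\<dots> = (deriv ^^ k) (\<lambda>z. euler_local n q z * euler_logderiv n q z) 0"
    by (rule higher_deriv_transform_within_open[where S = "ball 0 1"])
       (auto intro!: holomorphic_intros holomorphic_euler_local holomorphic_euler_logderiv n deriv_euler_local)
  also have "\<dots> = (\<Sum>i = 0..k. of_nat (k choose i) * (deriv ^^ i) (euler_local n q) 0 * (deriv ^^ (k - i)) (euler_logderiv n q) 0)"
    by (rule higher_deriv_mult[OF holomorphic_euler_local[OF n] holomorphic_euler_logderiv[OF n]]) auto
  finally show ?thesis .
qed

lemma nonneg_derivs_euler_local:
  assumes n: "n > 0" and sep: "chars_separate n"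
  shows "nonneg_derivs (euler_local n q)"
  unfolding nonneg_derivs_def
proof
  fix k
  show "(deriv ^^ k) (euler_local n q) 0 \<in> \<real>\<^sub>\<ge>\<^sub>0"
  proof (induction k rule: less_induct)
    case (less k)
    show ?case
    proof (cases k)
      case 0
      thus ?thesis by (simp add: euler_local_def)
    next
      case (Suc j)
      show ?thesis unfolding Suc higher_deriv_euler_local[OF n] higher_deriv_euler_logderiv[OF n sep]
        using less Suc by (intro nonneg_Reals_sum nonneg_Reals_mult_I nonneg_Reals_of_nat_I) auto
    qed
  qed
qed

lemma higher_deriv_monomial_0:
  "(deriv ^^ k) (\<lambda>z. c * z ^ m) 0 = (if k = m then c * fact m else (0 :: complex))"
proof -
  have "(deriv ^^ k) (\<lambda>z. c * z ^ m) 0 = c * (deriv ^^ k) (\<lambda>z. (z - 0) ^ m) 0"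
    by (subst higher_deriv_cmult[where A = UNIV]) (auto intro!: holomorphic_intros)
  also have "(deriv ^^ k) (\<lambda>z. (z - 0) ^ m) 0 = (if k = m then fact m else (0 :: complex))"
    unfolding higher_deriv_power
    by (cases "k < m") (auto simp: pochhammer_fact pochhammer_0_left Suc_diff_le not_less)
  finally show ?thesis by simp
qed

lemma nonneg_derivs_euler_local_minus_1:
  assumes n: "n > 0" and sep: "chars_separate n"
  shows "nonneg_derivs (\<lambda>z. euler_local n q z - 1)"
  unfolding nonneg_derivs_def
proof
  fix k
  have "(deriv ^^ k) (\<lambda>z. euler_local n q z - 1) 0 = (deriv ^^ k) (euler_local n q) 0 - (deriv ^^ k) (\<lambda>_. 1) 0"
    by (rule higher_deriv_diff[OF holomorphic_euler_local[OF n]]) auto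
  also have "\<dots> \<in> \<real>\<^sub>\<ge>\<^sub>0"
    using nonneg_derivs_euler_local[OF n sep, of q] by (cases "k = 0") (auto simp: nonneg_derivs_def euler_local_def)
  finally show "(deriv ^^ k) (\<lambda>z. euler_local n q z - 1) 0 \<in> \<real>\<^sub>\<ge>\<^sub>0" .
qed

text \<open>At order t the term \<open>i = 0\<close> of the recursion is already the coefficient c
  of the minorant, because q^t is congruent to 1 by Euler's theorem. All other terms are
  nonnegative.\<close>

lemma nonneg_derivs_euler_local_minus:
  assumes n: "n > 0" and sep: "chars_separate n" and q: "coprime q n"
  defines "t \<equiv> totient n" and "c \<equiv> of_nat (card (dchars n)) / of_nat (totient n)"
  shows "nonneg_derivs (\<lambda>z. euler_local n q z - (1 + c * z ^ t))"
  unfolding nonneg_derivs_def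
proof
  fix k
  obtain j where j: "t = Suc j" using n by (metis t_def totient_gt_0_iff gr0_conv_Suc)
  have E0: "euler_local n q 0 = 1" by (simp add: euler_local_def)
  have "(deriv ^^ k) (\<lambda>z. euler_local n q z - (1 + c * z ^ t)) 0 =
          (deriv ^^ k) (euler_local n q) 0 - (deriv ^^ k) (\<lambda>z. 1 + c * z ^ t) 0"
    by (rule higher_deriv_diff[OF holomorphic_euler_local[OF n]]) (auto intro!: holomorphic_intros)
  also have "(deriv ^^ k) (\<lambda>z. 1 + c * z ^ t) 0 = (deriv ^^ k) (\<lambda>_. 1) 0 + (deriv ^^ k) (\<lambda>z. c * z ^ t) 0"
    by (rule higher_deriv_add[where S = UNIV]) (auto intro!: holomorphic_intros)
  finally have eq: "(deriv ^^ k) (\<lambda>z. euler_local n q z - (1 + c * z ^ t)) 0 =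
      (deriv ^^ k) (euler_local n q) 0 - ((if k = 0 then 1 else 0) + (if k = t then c * fact t else 0))"
    by (simp add: higher_deriv_monomial_0)
  show "(deriv ^^ k) (\<lambda>z. euler_local n q z - (1 + c * z ^ t)) 0 \<in> \<real>\<^sub>\<ge>\<^sub>0"
  proof (cases "k = t")
    case False
    thus ?thesis unfolding eq using nonneg_derivs_euler_local[OF n sep, of q] j
      by (cases "k = 0") (auto simp: nonneg_derivs_def E0)
  next
    case True
    have "[q ^ t = 1] (mod n)" unfolding t_def by (rule euler_theorem[OF q])
    hence D: "(deriv ^^ j) (euler_logderiv n q) 0 = fact j * of_nat (card (dchars n))"
      unfolding higher_deriv_euler_logderiv[OF n sep] j by simp
    have c1: "c * fact t = fact j * of_nat (card (dchars n))"
      unfolding c_def t_def[symmetric] j by (simp add: field_simps del: of_nat_Suc)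
    have c2: "(deriv ^^ k) (euler_local n q) 0 = fact j * of_nat (card (dchars n)) +
      (\<Sum>i = Suc 0..j. of_nat (j choose i) * (deriv ^^ i) (euler_local n q) 0 * (deriv ^^ (j - i)) (euler_logderiv n q) 0)"
      unfolding True j higher_deriv_euler_local[OF n] by (subst sum.atLeast_Suc_atMost) (auto simp: E0 D)
    have c3: "(\<Sum>i = Suc 0..j. of_nat (j choose i) * (deriv ^^ i) (euler_local n q) 0 * (deriv ^^ (j - i)) (euler_logderiv n q) 0) \<in> \<real>\<^sub>\<ge>\<^sub>0"
      unfolding higher_deriv_euler_logderiv[OF n sep] using nonneg_derivs_euler_local[OF n sep, of q]
      by (intro nonneg_Reals_sum nonneg_Reals_mult_I nonneg_Reals_of_nat_I) (auto simp: nonneg_derivs_def)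
    have "k \<noteq> 0" using True j by simp
    thus ?thesis unfolding eq c1 c2 using True c3 by simp
  qed
qed

section \<open>Divergence over the primes congruent to 1\<close>

lemma sum_le_prod_one_plus:
  fixes a :: "'i \<Rightarrow> real"
  assumes "finite I" "\<And>i. i \<in> I \<Longrightarrow> a i \<ge> 0"
  shows "1 + sum a I \<le> (\<Prod>i\<in>I. 1 + a i)"
  using assms
proof (induction I rule: finite_induct)
  case (insert i I)
  have "1 + sum a (insert i I) \<le> (1 + a i) * (1 + sum a I)"
    using insert by (simp add: algebra_simps sum_nonneg)
  also have "\<dots> \<le> (1 + a i) * (\<Prod>i\<in>I. 1 + a i)"
    using insert by (intro mult_left_mono) auto
  finally show ?case using insert.hyps by simp
qed auto

theorem primes_cong_1_reciprocals_unbounded: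
  assumes n: "n > 0" and sep: "chars_separate n"
  shows "\<exists>N. (\<Sum>q\<in>primes_le N. if [q = 1] (mod n) then 1 / real q else 0) > B"
proof (rule ccontr)
  assume "\<not> ?thesis"
  hence B: "(\<Sum>q\<in>primes_le N. if [q = 1] (mod n) then 1 / real q else 0) \<le> B" for N
    by (simp add: not_less)
  obtain G where G: "G holomorphic_on {s. Re s > 0}" "\<And>s. Re s > 1 \<Longrightarrow> G s = dirichlet_prod n s"
    using dirichlet_prod_extends[OF n sep B] by metis
  define t where "t = totient n"
  have t: "t > 0" using n by (simp add: t_def)
  define c where "c = real (card (dchars n)) / real t"
  have c: "c > 0"
  proof -
    have "card (dchars n) > 0"
      using finite_dchars[OF n] dchars_principal[of n] by (auto simp: card_gt_0_iff)
    thus ?thesis using t by (simp add: c_def)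
  qed
  \<comment> \<open>q^(-s) in the variable w = 2 - s; its Taylor coefficients at 0 are q^(-2) (ln
    q)^k / k!.\<close>
  define u where "u = (\<lambda>q w. of_nat q powr (-(2 - w)) :: complex)"
  have u_hol: "u q holomorphic_on A" if "prime q" for q A
    unfolding u_def using prime_gt_0_nat[OF that] by (intro holomorphic_intros) auto
  have u_nonneg_derivs: "nonneg_derivs (u q)" if "prime q" for q
  proof -
    have "q > 0" using that prime_gt_0_nat by blast
    have "u q = (\<lambda>w. of_real (real q powr (-2)) * exp (of_real (ln (real q)) * w))"
    proof
      fix w
      have "u q w = exp (-(2 - w) * of_real (ln (real q)))"
        using \<open>q > 0\<close> by (simp add: u_def powr_def Ln_of_nat)
      also have "-(2 - w) * of_real (ln (real q)) = of_real (-2 * ln (real q)) + of_real (ln (real q)) * w"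
        by (simp add: algebra_simps)
      also have "exp \<dots> = of_real (exp (-2 * ln (real q))) * exp (of_real (ln (real q)) * w)"
        by (simp only: exp_add exp_of_real)
      also have "exp (-2 * ln (real q)) = real q powr (-2)" using \<open>q > 0\<close> by (simp add: powr_def)
      finally show "u q w = of_real (real q powr (-2)) * exp (of_real (ln (real q)) * w)" .
    qed
    moreover have "nonneg_derivs (\<lambda>w. of_real (real q powr (-2)) * exp (of_real (ln (real q)) * w))"
      using \<open>q > 0\<close> by (intro nonneg_derivs_mult[where r = 1] nonneg_derivs_const nonneg_derivs_exp holomorphic_intros) auto
    ultimately show ?thesis by simp
  qed
  have u_norm: "norm (u q w) \<le> 1 / 2" if "prime q" "w \<in> ball 0 1" for q w
  proof -
    have q: "real q \<ge> 2" using prime_ge_2_nat[OF that(1)] by simp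
    have "Re w \<le> 1" using that(2) complex_Re_le_cmod[of w] by simp
    have "norm (u q w) = real q powr (-(2 - Re w))"
      unfolding u_def using q by (subst norm_of_nat_powr) auto
    also have "\<dots> \<le> real q powr (-1)" using \<open>Re w \<le> 1\<close> q by (intro powr_mono) auto
    also have "\<dots> = 1 / real q" using q by (simp add: powr_minus_divide)
    also have "\<dots> \<le> 1 / 2" using q by (intro divide_left_mono) auto
    finally show ?thesis .
  qed
  define f where "f = (\<lambda>q w. euler_factor n q (2 - w))"
  have f_eq: "f q w = euler_local n q (u q w)" for q w
    by (simp add: f_def u_def euler_factor_def euler_local_def)
  have f_hol: "f q holomorphic_on ball 0 1" if "prime q" for q
  proof -
    have "euler_local n q \<circ> u q holomorphic_on ball 0 1"
    proof (rule holomorphic_on_compose_gen[OF u_hol[OF that] holomorphic_euler_local[OF n]])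
      show "u q ` ball 0 1 \<subseteq> ball 0 1"
      proof (rule image_subsetI)
        fix w :: complex assume "w \<in> ball 0 1"
        from u_norm[OF that this] show "u q w \<in> ball 0 1" by simp
      qed
    qed
    thus ?thesis by (simp add: o_def f_eq[abs_def])
  qed
  have "(\<Sum>q\<in>primes_le N. if coprime q n then c / real q else 0) \<le> Re (G (of_real (1 / real t)))" for N
  proof -
    \<comment> \<open>The minorant uses the primes up to the fixed \<open>N\<close> and is 1
      elsewhere, so its product no longer changes once the Euler product runs past
      \<open>N\<close>.\<close>
    define h where "h = (\<lambda>q w. if coprime q n \<and> q \<le> N then 1 + of_real c * u q w ^ t else 1)"
    have h_hol: "h q holomorphic_on A" if "prime q" for q A
      unfolding h_def by (cases "coprime q n \<and> q \<le> N") (auto intro!: holomorphic_intros u_hol that)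
    define H where "H = (\<lambda>w. \<Prod>q\<in>primes_le N. h q w)"
    have H_hol: "H holomorphic_on A" for A
      unfolding H_def by (intro holomorphic_intros h_hol) (auto simp: primes_le_def)
    have diff: "nonneg_derivs (\<lambda>w. (\<Prod>q\<in>primes_le M. f q w) - (\<Prod>q\<in>primes_le M. h q w))" for M
    proof (rule nonneg_derivs_diff_prod[where r = 1])
      fix q assume "q \<in> primes_le M"
      hence q: "prime q" by (auto simp: primes_le_def)
      show "f q holomorphic_on ball 0 1" "h q holomorphic_on ball 0 1" using f_hol h_hol q by auto
      have upow: "nonneg_derivs (\<lambda>w. u q w ^ t)"
        using nonneg_derivs_prod[of 1 "{..<t}" "\<lambda>_. u q"] u_hol[OF q] u_nonneg_derivs[OF q] by simp
      show "nonneg_derivs (h q)"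
      proof (cases "coprime q n \<and> q \<le> N")
        case True
        have "nonneg_derivs (\<lambda>w. 1 + of_real c * u q w ^ t)"
          using c by (intro nonneg_derivs_add[where r = 1] nonneg_derivs_mult[where r = 1] nonneg_derivs_const upow holomorphic_intros u_hol q) auto
        thus ?thesis using True by (simp add: h_def)
      qed (use nonneg_derivs_const[of 1] in \<open>auto simp: h_def\<close>)
      show "nonneg_derivs (\<lambda>w. f q w - h q w)"
      proof (cases "coprime q n \<and> q \<le> N")
        case True
        have "nonneg_derivs (\<lambda>z. euler_local n q z - (1 + of_nat (card (dchars n)) / of_nat (totient n) * z ^ totient n))"
          using nonneg_derivs_euler_local_minus[OF n sep] True by blast
        moreover have "(\<lambda>z. euler_local n q z - (1 + of_nat (card (dchars n)) / of_nat (totient n) * z ^ totient n))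
            holomorphic_on ball 0 1"
          by (intro holomorphic_intros holomorphic_euler_local n)
        ultimately have "nonneg_derivs (\<lambda>w. euler_local n q (u q w) -
            (1 + of_nat (card (dchars n)) / of_nat (totient n) * u q w ^ totient n))"
          using nonneg_derivs_compose[OF _ _ u_hol[OF q] u_nonneg_derivs[OF q] zero_less_one u_norm[OF q]] by blast
        thus ?thesis using True by (simp add: h_def f_eq c_def t_def)
      next
        case False
        have "(\<lambda>z. euler_local n q z - 1) holomorphic_on ball 0 1"
          by (intro holomorphic_intros holomorphic_euler_local n)
        hence "nonneg_derivs (\<lambda>w. euler_local n q (u q w) - 1)"
          using nonneg_derivs_compose[OF _ nonneg_derivs_euler_local_minus_1[OF n sep] u_hol[OF q] u_nonneg_derivs[OF q] zero_less_one u_norm[OF q]]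
          by blast
        thus ?thesis using False by (auto simp: h_def f_eq)
      qed
    qed auto
    have H_eq: "(\<Prod>q\<in>primes_le M. h q w) = H w" if "M \<ge> N" for M w
      unfolding H_def using that by (intro prod.mono_neutral_right) (auto simp: primes_le_def[of M] primes_le_def[of N] h_def)
    have ev: "\<forall>\<^sub>F M in sequentially. nonneg_derivs (\<lambda>w. (\<Prod>q\<in>primes_le M. f q w) - H w)"
    proof (rule eventually_mono[OF eventually_ge_at_top[of N]])
      fix M assume "M \<ge> N"
      show "nonneg_derivs (\<lambda>w. (\<Prod>q\<in>primes_le M. f q w) - H w)"
        using diff[of M] unfolding H_eq[OF \<open>M \<ge> N\<close>] .
    qed
    have Re2: "Re (2 - w) \<ge> 3 / 2" if "w \<in> ball 0 (1/2)" for w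
      using that complex_Re_le_cmod[of w] by simp
    \<comment> \<open>On this small disc \<open>Re s\<close> is at least 3/2, inside the region of
      convergence; that is enough to compare Taylor coefficients at w = 0.\<close>
    have "uniform_limit (ball 0 (1/2)) (\<lambda>M w. \<Prod>q\<in>primes_le M. f q w) (\<lambda>w. dirichlet_prod n (2 - w)) sequentially"
      unfolding f_def
      using uniform_limit_compose'[OF uniform_limit_euler_factors[OF n, of "3/2"], of "\<lambda>w. 2 - w" "ball 0 (1/2)"] Re2
      by (auto simp: Pi_iff)
    moreover have "dirichlet_prod n (2 - w) = G (2 - w)" if "w \<in> ball 0 (1/2)" for w
      using Re2[OF that] by (intro G(2)[symmetric]) linarith
    ultimately have "uniform_limit (ball 0 (1/2)) (\<lambda>M w. \<Prod>q\<in>primes_le M. f q w) (\<lambda>w. G (2 - w)) sequentially"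
      using uniform_limit_cong'[of "ball 0 (1/2)" "\<lambda>M w. \<Prod>q\<in>primes_le M. f q w" "\<lambda>M w. \<Prod>q\<in>primes_le M. f q w"
          "\<lambda>w. dirichlet_prod n (2 - w)" "\<lambda>w. G (2 - w)"] by blast
    hence "uniform_limit (ball 0 (1/2)) (\<lambda>M w. (\<Prod>q\<in>primes_le M. f q w) - H w) (\<lambda>w. G (2 - w) - H w) sequentially"
      by (intro uniform_limit_minus uniform_limit_const)
    hence pos: "nonneg_derivs (\<lambda>w. G (2 - w) - H w)"
    proof (rule nonneg_derivs_limit)
      show "(\<lambda>w. (\<Prod>q\<in>primes_le M. f q w) - H w) holomorphic_on ball 0 (1/2)" for M
        by (intro holomorphic_intros H_hol holomorphic_on_subset[OF f_hol]) (auto simp: primes_le_def)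
    qed (use ev in auto)
    have "(\<lambda>w. G (2 - w)) holomorphic_on ball 0 2"
    proof -
      have "G \<circ> (\<lambda>w. 2 - w) holomorphic_on ball 0 2"
      proof (rule holomorphic_on_compose_gen[OF _ G(1)])
        show "(\<lambda>w. 2 - w) ` ball 0 2 \<subseteq> {s::complex. Re s > 0}"
        proof (rule image_subsetI)
          fix w :: complex assume "w \<in> ball 0 2"
          thus "2 - w \<in> {s. Re s > 0}" using complex_Re_le_cmod[of w] by simp
        qed
      qed (auto intro!: holomorphic_intros)
      thus ?thesis by (simp add: o_def)
    qed
    hence hol2: "(\<lambda>w. G (2 - w) - H w) holomorphic_on ball 0 2"
      by (intro holomorphic_intros H_hol)
    \<comment> \<open>This is the point s = 1/t, where the minorant's term q^(-ts) becomes 1/q. It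
      lies in the disc of radius 2 on which the extension is holomorphic.\<close>
    define x where "x = 2 - 1 / real t"
    have "1 / real t \<le> 1" "1 / real t > 0" using t by simp_all
    hence x: "0 \<le> x" "x < 2" unfolding x_def by linarith+
    have "G (2 - of_real x) - H (of_real x) \<in> \<real>\<^sub>\<ge>\<^sub>0"
      using nonneg_derivs_imp_nonneg[OF hol2 pos x] .
    moreover have "2 - complex_of_real x = of_real (1 / real t)" by (simp add: x_def)
    moreover have "H (of_real x) = of_real (\<Prod>q\<in>primes_le N. 1 + (if coprime q n then c / real q else 0))"
      unfolding H_def of_real_prod
    proof (intro prod.cong refl)
      fix q assume q: "q \<in> primes_le N"
      hence "q > 0" by (auto simp: primes_le_def prime_gt_0_nat)
      have "u q (of_real x) = of_real (real q powr (-(1 / real t)))"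
        using powr_of_real[of "real q" "-(1 / real t)"] \<open>q > 0\<close> unfolding u_def x_def by simp
      moreover have "(real q powr (-(1 / real t))) ^ t = 1 / real q"
        using \<open>q > 0\<close> t by (subst powr_power) (auto simp: powr_minus_divide)
      ultimately have "u q (of_real x) ^ t = of_real (1 / real q)" by (metis of_real_power)
      thus "h q (of_real x) = of_real (1 + (if coprime q n then c / real q else 0))"
        using q by (simp add: h_def primes_le_def)
    qed
    ultimately have "(\<Prod>q\<in>primes_le N. 1 + (if coprime q n then c / real q else 0)) \<le> Re (G (of_real (1 / real t)))"
      by (simp only: complex_nonneg_Reals_iff minus_complex.sel Re_complex_of_real) linarith
    moreover have "1 + (\<Sum>q\<in>primes_le N. if coprime q n then c / real q else 0) \<le>
        (\<Prod>q\<in>primes_le N. 1 + (if coprime q n then c / real q else 0))"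
      using c by (intro sum_le_prod_one_plus) auto
    ultimately show ?thesis by linarith
  qed
  \<comment> \<open>Primes dividing \<open>n\<close> are missing from the bounded sum. They are
    finitely many and each adds at most \<open>c\<close>.\<close>
  moreover have "c * (\<Sum>q\<in>primes_le N. 1 / real q) \<le>
      (\<Sum>q\<in>primes_le N. if coprime q n then c / real q else 0) + c * card (prime_factors n)" for N
  proof -
    have "c * (\<Sum>q\<in>primes_le N. 1 / real q) =
        (\<Sum>q\<in>primes_le N. (if coprime q n then c / real q else 0) + (if coprime q n then 0 else c / real q))"
      unfolding sum_distrib_left by (intro sum.cong) auto
    also have "\<dots> = (\<Sum>q\<in>primes_le N. if coprime q n then c / real q else 0) +
        (\<Sum>q\<in>primes_le N. if coprime q n then 0 else c / real q)"
      by (rule sum.distrib)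
    also have "(\<Sum>q\<in>primes_le N. if coprime q n then 0 else c / real q) =
        (\<Sum>q\<in>{q\<in>primes_le N. \<not> coprime q n}. c / real q)"
      by (subst sum.inter_filter) (auto intro!: sum.cong)
    also have "\<dots> \<le> (\<Sum>q\<in>{q\<in>primes_le N. \<not> coprime q n}. c)"
      using c by (intro sum_mono) (auto simp: primes_le_def divide_le_eq_1 mult_le_cancel_left1 divide_le_eq dest: prime_gt_0_nat prime_ge_1_nat)
    also have "\<dots> = c * card {q\<in>primes_le N. \<not> coprime q n}" by simp
    also have "\<dots> \<le> c * card (prime_factors n)"
    proof (intro mult_left_mono of_nat_mono card_mono)
      show "{q \<in> primes_le N. \<not> coprime q n} \<subseteq> prime_factors n"
        using n by (auto simp: primes_le_def prime_factors_dvd dest: prime_imp_coprime)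
    qed (use c in auto)
    finally show ?thesis by simp
  qed
  ultimately have "c * (\<Sum>q\<in>primes_le N. 1 / real q) \<le> Re (G (of_real (1 / real t))) + c * card (prime_factors n)" for N
    by (meson add_right_mono order.trans)
  hence "(\<Sum>q\<in>primes_le N. 1 / real q) \<le> (Re (G (of_real (1 / real t))) + c * card (prime_factors n)) / c" for N
    using c by (simp add: field_simps)
  thus False using prime_reciprocals_unbounded not_less by metis
qed

section \<open>The arithmetic criterion\<close>

text \<open>Each gcd divides the other argument, by comparing multiplicities at every prime.\<close>

lemma gcd_eq_if_prime_powers_agree:
  fixes m x y :: nat
  assumes m: "m > 0" and eq: "\<And>p j. prime p \<Longrightarrow> j > 0 \<Longrightarrow> p ^ j dvd m \<Longrightarrow> p ^ j dvd x \<longleftrightarrow> p ^ j dvd y"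
  shows "gcd m x = gcd m y"
proof -
  have *: "gcd m u dvd v"
    if "\<And>p j. prime p \<Longrightarrow> j > 0 \<Longrightarrow> p ^ j dvd m \<Longrightarrow> p ^ j dvd u \<Longrightarrow> p ^ j dvd v" for u v :: nat
  proof (cases "v = 0")
    case False
    show ?thesis
    proof (rule multiplicity_le_imp_dvd)
      show "gcd m u \<noteq> 0" using m by simp
      fix p :: nat assume p: "prime p"
      define j where "j = multiplicity p (gcd m u)"
      have "p ^ j dvd gcd m u" unfolding j_def by (rule multiplicity_dvd)
      hence "p ^ j dvd v" using that[OF p, of j] by (cases "j = 0") auto
      thus "j \<le> multiplicity p v"
        using False p by (intro multiplicity_geI) auto
    qed
  qed auto
  show ?thesis
    using *[of x y] *[of y x] eq by (intro dvd_antisym gcd_greatest) auto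
qed

text \<open>With k = m / rad m, the quotient in \<open>f_fun\<close> becomes
  \<open>delta m * Carmichael m div k\<close>. The doubled exponent in \<open>cond\<close> pays for
  this division: \<open>k\<close> takes at most \<open>multiplicity p m\<close> factors p, and as
  many remain.\<close>

lemma d_fun_eq_f_fun:
  assumes m: "m > 0"
    and cond: "\<And>p. prime p \<Longrightarrow> p\<^sup>2 dvd m \<Longrightarrow> \<exists>q. prime q \<and> q dvd m \<and> [q = 1] (mod p ^ (2 * multiplicity p m))"
  shows "d_fun m = f_fun m"
proof -
  define k where "k = (\<Prod>p\<in>prime_factors m. p ^ (multiplicity p m - 1))"
  have "m = (\<Prod>p\<in>prime_factors m. p ^ multiplicity p m)"
    using m by (intro Primes.prime_factorization_nat) auto
  also have "\<dots> = (\<Prod>p\<in>prime_factors m. p ^ (multiplicity p m - 1) * p)"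
  proof (rule prod.cong)
    fix p assume "p \<in> prime_factors m"
    hence "multiplicity p m > 0" by (simp add: prime_factors_multiplicity)
    thus "p ^ multiplicity p m = p ^ (multiplicity p m - 1) * p" by (cases "multiplicity p m") auto
  qed auto
  finally have mk: "m = k * rad m" by (simp add: k_def rad_def prod.distrib)
  have km: "k dvd m" using dvd_triv_left[of k "rad m"] by (simp only: mk[symmetric])
  \<comment> \<open>Since \<open>m = k * rad m\<close>, a prime dividing \<open>m\<close> exactly
    once cannot divide \<open>k\<close>.\<close>
  have pp: "p\<^sup>2 dvd m" if "p dvd k" "p dvd rad m" for p
    using mult_dvd_mono[OF that] by (simp only: mk[symmetric] power2_eq_square)
  have "pairwise coprime ((\<lambda>p. p) ` prime_factors m)"
    by (auto simp: pairwise_def intro: primes_coprime)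
  hence "totient (rad m) = (\<Prod>p\<in>prime_factors m. totient p)"
    unfolding rad_def by (intro totient_prod_coprime) auto
  also have "\<dots> = (\<Prod>p\<in>prime_factors m. p - 1)"
    by (intro prod.cong refl totient_prime) auto
  finally have tr: "totient (rad m) = (\<Prod>p\<in>prime_factors m. p - 1)" .
  have tm: "totient m = k * totient (rad m)"
    unfolding totient_formula1[OF m] tr k_def by (simp add: prod.distrib)
  have k0: "k > 0" using mk m by (cases k) auto
  have r0: "totient (rad m) > 0" using tm m by (metis gr0I mult_0_right totient_gt_0_iff less_irrefl)
  have q1: "q - 1 dvd totient (rad m)" "q - 1 dvd Carmichael m" if "prime q" "q dvd m" for q
  proof -
    have q: "q \<in> prime_factors m" using that m by (simp add: prime_factors_dvd)
    show "q - 1 dvd totient (rad m)" unfolding tr using q by (intro dvd_prodI) auto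
    have "q - 1 dvd (let k = multiplicity q m in if q = 2 \<and> k > 2 then 2 ^ (k - 2) else q ^ (k - 1) * (q - 1))"
      by (auto simp: Let_def)
    also have "\<dots> dvd Carmichael m"
      unfolding Carmichael_closed_formula[of m] using q by (intro dvd_Lcm) blast
    finally show "q - 1 dvd Carmichael m" .
  qed
  have big: "p ^ (2 * multiplicity p m) dvd totient (rad m)" "p ^ (2 * multiplicity p m) dvd Carmichael m"
    if p: "prime p" "p\<^sup>2 dvd m" for p
  proof -
    obtain q where q: "prime q" "q dvd m" "[q = 1] (mod p ^ (2 * multiplicity p m))"
      using cond[OF p] by blast
    have "p ^ (2 * multiplicity p m) dvd q - 1"
      using q(3) prime_ge_1_nat[OF q(1)] by (simp add: cong_altdef_nat cong_sym_eq)
    thus "p ^ (2 * multiplicity p m) dvd totient (rad m)" "p ^ (2 * multiplicity p m) dvd Carmichael m"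
      using q1[OF q(1,2)] dvd_trans by blast+
  qed
  have sq: "p\<^sup>2 dvd m" if "multiplicity p m \<ge> 2" for p
    using that multiplicity_dvd'[of 2 p m] by simp
  \<comment> \<open>This makes the quotient exact: primes whose square divides \<open>m\<close> are
    covered by \<open>big\<close>, and no other prime divides \<open>k\<close>.\<close>
  have kC: "k dvd Carmichael m"
  proof (rule multiplicity_le_imp_dvd)
    show "k \<noteq> 0" using k0 by simp
    fix p :: nat assume p: "prime p"
    have kle: "multiplicity p k \<le> multiplicity p m"
      using km m by (intro dvd_imp_multiplicity_le) auto
    show "multiplicity p k \<le> multiplicity p (Carmichael m)"
    proof (cases "multiplicity p m \<ge> 2")
      case True
      have "2 * multiplicity p m \<le> multiplicity p (Carmichael m)"
        using big(2)[OF p sq[OF True]] p by (intro multiplicity_geI) auto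
      thus ?thesis using kle by linarith
    next
      case False
      have "multiplicity p k = 0"
      proof (rule ccontr)
        assume "multiplicity p k \<noteq> 0"
        hence pk: "p dvd k" using not_dvd_imp_multiplicity_0[of p k] by argo
        hence "p dvd m" using km by (rule dvd_trans)
        hence "p \<in> prime_factors m" using p m by (simp add: prime_factors_dvd)
        hence "p dvd rad m" unfolding rad_def by (intro dvd_prodI) auto
        hence "p\<^sup>2 dvd m" using pp[OF pk] by blast
        hence "multiplicity p m \<ge> 2" using p m by (intro multiplicity_geI) auto
        thus False using False by simp
      qed
      thus ?thesis by simp
    qed
  qed
  define e where "e = delta m * (Carmichael m div k)"
  have ek: "e * k = delta m * Carmichael m" using kC by (simp add: e_def)
  have "delta m * Carmichael m * totient (rad m) div totient m = e"
    unfolding tm ek[symmetric] using k0 r0 by (simp add: mult.assoc)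
  hence f: "f_fun m = gcd m e" by (simp add: f_fun_def)
  have e0: "e \<noteq> 0" using ek by (metis Carmichael_nonzero delta_def mult_eq_0_iff one_neq_zero zero_neq_numeral)
  show ?thesis
    unfolding f d_fun_def
  proof (rule gcd_eq_if_prime_powers_agree[OF m])
    fix p j :: nat assume p: "prime p" and j: "j > 0" "p ^ j dvd m"
    have ja: "j \<le> multiplicity p m" using j p m by (intro multiplicity_geI) auto
    show "p ^ j dvd delta m * totient (rad m) \<longleftrightarrow> p ^ j dvd e"
    proof (cases "multiplicity p m \<ge> 2")
      case True
      have "p ^ j dvd p ^ (2 * multiplicity p m)" using ja by (intro le_imp_power_dvd) auto
      hence "p ^ j dvd delta m * totient (rad m)"
        using big(1)[OF p sq[OF True]] by (meson dvd_mult dvd_trans)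
      moreover have "p ^ j dvd e"
      proof -
        \<comment> \<open>At least 2 v factors p in \<open>e * k\<close>, with at most v of them in
          \<open>k\<close>, leave v in \<open>e\<close>, where v is
          \<open>multiplicity p m\<close>.\<close>
        have "p ^ (2 * multiplicity p m) dvd e * k"
          unfolding ek using big(2)[OF p sq[OF True]] by (rule dvd_mult)
        hence "2 * multiplicity p m \<le> multiplicity p (e * k)"
          using p e0 k0 by (intro multiplicity_geI) auto
        also have "\<dots> = multiplicity p e + multiplicity p k"
          using p e0 k0 by (intro prime_elem_multiplicity_mult_distrib) auto
        also have "multiplicity p k \<le> multiplicity p m"
          using km m by (intro dvd_imp_multiplicity_le) auto
        finally have "j \<le> multiplicity p e" using ja by linarith
        thus ?thesis by (rule multiplicity_dvd')
      qed
      ultimately show ?thesis by blast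
    next
      case False
      hence j1: "j = 1" and a1: "multiplicity p m = 1" using ja j by auto
      have pm: "p dvd m" using j j1 by simp
      hence "p \<in> prime_factors m" using p m by (simp add: prime_factors_dvd)
      hence prad: "p dvd rad m" unfolding rad_def by (intro dvd_prodI) auto
      have pk: "\<not> p dvd k"
      proof
        assume "p dvd k"
        hence "p\<^sup>2 dvd m" using prad by (rule pp)
        hence "multiplicity p m \<ge> 2" using p m by (intro multiplicity_geI) auto
        thus False using a1 by simp
      qed
      \<comment> \<open>\<open>delta m\<close> can only contribute the prime 2, and only when 4
        divides \<open>m\<close>.\<close>
      have pd: "\<not> p dvd delta m"
      proof
        assume "p dvd delta m"
        hence "p = 2" "4 dvd m"
          using p primes_dvd_imp_eq[of p 2] by (auto simp: delta_def split: if_splits)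
        hence "p\<^sup>2 dvd m" by simp
        hence "multiplicity p m \<ge> 2" using p m by (intro multiplicity_geI) auto
        thus False using a1 by simp
      qed
      have "p dvd e \<longleftrightarrow> p dvd e * k" using pk p by (simp add: prime_dvd_mult_iff)
      also have "\<dots> \<longleftrightarrow> p dvd Carmichael m" unfolding ek using pd p by (simp add: prime_dvd_mult_iff)
      \<comment> \<open>For such p both sides mean that p divides q - 1 for some prime factor q of
        \<open>m\<close>.\<close>
      also have "\<dots> \<longleftrightarrow> p dvd totient (rad m)"
      proof
        assume "p dvd Carmichael m"
        hence "p dvd k * totient (rad m)" using Carmichael_dvd_totient[of m] tm dvd_trans by metis
        thus "p dvd totient (rad m)" using pk p by (simp add: prime_dvd_mult_iff)
      next
        assume "p dvd totient (rad m)"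
        then obtain q where "q \<in> prime_factors m" "p dvd q - 1"
          unfolding tr using p by (auto simp: prime_dvd_prod_iff)
        thus "p dvd Carmichael m" using q1(2)[of q] by (auto simp: prime_factors_dvd intro: dvd_trans)
      qed
      also have "\<dots> \<longleftrightarrow> p dvd delta m * totient (rad m)" using pd p by (simp add: prime_dvd_mult_iff)
      finally show ?thesis using j1 by simp
    qed
  qed
qed

section \<open>Densities\<close>

text \<open>The bound on \<open>k\<close> comes from the prime 2, where 5 and -1 serve as
  generators.\<close>

lemma chars_separate_prime_power:
  assumes "prime p" "k \<ge> 3"
  shows "chars_separate (p ^ k)"
  unfolding chars_separate_def
proof (intro allI impI)
  fix a assume a: "coprime a (p ^ k)" "\<not> [a = 1] (mod p ^ k)"
  show "\<exists>\<psi>\<in>dchars (p ^ k). \<psi> a \<noteq> 1"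
  proof (cases "p = 2")
    case True
    show ?thesis using dchars_separate_power_of_2[OF assms(2)] a unfolding True by blast
  next
    case False
    hence "odd p" using assms(1) primes_dvd_imp_eq[of 2 p] by auto
    thus ?thesis using dchars_separate_odd_prime_power[OF assms(1) _ _ a] assms(2) by simp
  qed
qed

text \<open>An upper density bound with the constant \<open>e\<close> itself holding eventually, so
  that bounds add under finite unions. Density zero is expressed by all
  \<open>e > 0\<close>.\<close>

definition density_le :: "nat set \<Rightarrow> real \<Rightarrow> bool" where
  "density_le S e \<longleftrightarrow> (\<forall>\<^sub>F N in sequentially. real (card (S \<inter> {1..N})) \<le> e * real N)"

lemma density_le_Un:
  assumes "density_le S a" "density_le T b"
  shows "density_le (S \<union> T) (a + b)"
  using assms unfolding density_le_def
proof eventually_elim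
  case (elim N)
  have "card ((S \<union> T) \<inter> {1..N}) \<le> card (S \<inter> {1..N}) + card (T \<inter> {1..N})"
    unfolding Int_Un_distrib2 by (rule card_Un_le)
  thus ?case using elim by (simp add: algebra_simps)
qed

lemma density_le_subset:
  assumes "density_le T e" "S \<subseteq> T"
  shows "density_le S e"
  using assms(1) unfolding density_le_def
proof eventually_elim
  case (elim N)
  have "card (S \<inter> {1..N}) \<le> card (T \<inter> {1..N})" using assms(2) by (intro card_mono) auto
  thus ?case using elim by linarith
qed

lemma density_le_mono: "density_le S a \<Longrightarrow> a \<le> b \<Longrightarrow> density_le S b"
  unfolding density_le_def by (erule eventually_mono) (meson mult_right_mono of_nat_0_le_iff order.trans)

lemma density_zero_UN:
  assumes "finite I" "\<And>i e. i \<in> I \<Longrightarrow> e > 0 \<Longrightarrow> density_le (S i) e" "e > 0"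
  shows "density_le (\<Union>i\<in>I. S i) e"
  using assms
proof (induction I arbitrary: e rule: finite_induct)
  case empty
  thus ?case by (simp add: density_le_def)
next
  case (insert i I)
  have "density_le (S i) (e / 2)" using insert.prems by auto
  moreover have "density_le (\<Union>i\<in>I. S i) (e / 2)"
    using insert.prems by (intro insert.IH) auto
  ultimately have "density_le (S i \<union> (\<Union>i\<in>I. S i)) (e / 2 + e / 2)" by (rule density_le_Un)
  thus ?case by simp
qed

lemma card_multiples_le: "real (card ({m. k dvd m} \<inter> {1..N})) \<le> real N / real k"
proof (cases "k = 0")
  \<comment> \<open>Here the right-hand side is 0 by the convention for division by 0, and 0 divides
    no positive integer.\<close>
  case True
  hence "{m. k dvd m} \<inter> {1..N} = {}" by auto
  thus ?thesis using True by simp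
next
  case False
  have "{m. k dvd m} \<inter> {1..N} \<subseteq> (\<lambda>i. k * i) ` {1..N div k}"
  proof
    fix m assume m: "m \<in> {m. k dvd m} \<inter> {1..N}"
    then obtain i where i: "m = k * i" by auto
    have "i \<le> N div k" using m i False by (simp add: less_eq_div_iff_mult_less_eq mult.commute)
    moreover have "i \<ge> 1" using m i by (cases i) auto
    ultimately show "m \<in> (\<lambda>i. k * i) ` {1..N div k}" using i by auto
  qed
  hence "card ({m. k dvd m} \<inter> {1..N}) \<le> card {1..N div k}"
    by (rule surj_card_le[rotated]) simp
  hence "real (card ({m. k dvd m} \<inter> {1..N})) \<le> real (N div k)" by simp
  also have "\<dots> \<le> real N / real k" by (rule of_nat_div_le_of_nat)
  finally show ?thesis .
qed

text \<open>Telescoping: 1/k^2 is at most 1/(k-1) - 1/k.\<close>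

lemma sum_inverse_squares_tail_le:
  assumes "Y > 0"
  shows "(\<Sum>k = Suc Y..N. 1 / real k ^ 2) \<le> 1 / real Y"
proof -
  have "(\<Sum>k = Suc Y..N. 1 / real k ^ 2) \<le> 1 / real Y - 1 / real N" if "N \<ge> Y"
    using that
  proof (induction N rule: dec_induct)
    case (step N)
    have N: "real N > 0" using assms step by simp
    have "1 / real (Suc N) ^ 2 \<le> 1 / (real N * real (Suc N))"
      using N by (intro divide_left_mono) (auto simp: power2_eq_square)
    also have "\<dots> = 1 / real N - 1 / real (Suc N)" using N by (simp add: field_simps)
    finally have "1 / real (Suc N) ^ 2 \<le> 1 / real N - 1 / real (Suc N)" .
    thus ?case using step by simp
  qed auto
  moreover have "1 / real N \<ge> 0" by simp
  ultimately show ?thesis by (cases "N \<ge> Y") (auto intro: order.trans)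
qed

lemma density_le_large_square_divisor:
  assumes "Y > 0"
  shows "density_le {m. \<exists>k>Y. k\<^sup>2 dvd m} (1 / real Y)"
  unfolding density_le_def
proof (rule always_eventually, rule allI)
  fix N
  have "{m. \<exists>k>Y. k\<^sup>2 dvd m} \<inter> {1..N} \<subseteq> (\<Union>k\<in>{Suc Y..N}. {m. k\<^sup>2 dvd m} \<inter> {1..N})"
  proof
    fix m assume "m \<in> {m. \<exists>k>Y. k\<^sup>2 dvd m} \<inter> {1..N}"
    then obtain k where k: "k > Y" "k\<^sup>2 dvd m" "m \<ge> 1" "m \<le> N" by auto
    have "k \<le> k\<^sup>2" by (simp add: power2_eq_square)
    also have "\<dots> \<le> m" using k by (intro dvd_imp_le) auto
    finally show "m \<in> (\<Union>k\<in>{Suc Y..N}. {m. k\<^sup>2 dvd m} \<inter> {1..N})" using k by auto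
  qed
  hence "card ({m. \<exists>k>Y. k\<^sup>2 dvd m} \<inter> {1..N}) \<le> card (\<Union>k\<in>{Suc Y..N}. {m. k\<^sup>2 dvd m} \<inter> {1..N})"
    by (intro card_mono) auto
  also have "\<dots> \<le> (\<Sum>k = Suc Y..N. card ({m. k\<^sup>2 dvd m} \<inter> {1..N}))"
    by (rule card_UN_le) simp
  finally have "real (card ({m. \<exists>k>Y. k\<^sup>2 dvd m} \<inter> {1..N})) \<le> (\<Sum>k = Suc Y..N. real (card ({m. k\<^sup>2 dvd m} \<inter> {1..N})))"
    unfolding of_nat_sum[symmetric] of_nat_le_iff .
  also have "\<dots> \<le> (\<Sum>k = Suc Y..N. real N * (1 / real k ^ 2))"
    by (intro sum_mono order.trans[OF card_multiples_le]) auto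
  also have "\<dots> = real N * (\<Sum>k = Suc Y..N. 1 / real k ^ 2)" by (rule sum_distrib_left[symmetric])
  also have "\<dots> \<le> real N * (1 / real Y)"
    by (intro mult_left_mono sum_inverse_squares_tail_le assms) auto
  finally show "real (card ({m. \<exists>k>Y. k\<^sup>2 dvd m} \<inter> {1..N})) \<le> 1 / real Y * real N"
    by (simp add: mult.commute)
qed

lemma density_le_small_power_divisor:
  "density_le {m. \<exists>k\<in>{2..Y}. k ^ A dvd m} (real Y / 2 ^ A)"
  unfolding density_le_def
proof (rule always_eventually, rule allI)
  fix N
  have "{m. \<exists>k\<in>{2..Y}. k ^ A dvd m} \<inter> {1..N} = (\<Union>k\<in>{2..Y}. {m. k ^ A dvd m} \<inter> {1..N})" by auto
  hence "card ({m. \<exists>k\<in>{2..Y}. k ^ A dvd m} \<inter> {1..N}) \<le> (\<Sum>k = 2..Y. card ({m. k ^ A dvd m} \<inter> {1..N}))"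
    by (simp only: card_UN_le finite_atLeastAtMost)
  hence "real (card ({m. \<exists>k\<in>{2..Y}. k ^ A dvd m} \<inter> {1..N})) \<le> (\<Sum>k = 2..Y. real (card ({m. k ^ A dvd m} \<inter> {1..N})))"
    unfolding of_nat_sum[symmetric] of_nat_le_iff .
  also have "\<dots> \<le> (\<Sum>k = 2..Y. real N / 2 ^ A)"
  proof (rule sum_mono)
    fix k assume k: "k \<in> {2..Y}"
    have "real N / real (k ^ A) \<le> real N / 2 ^ A"
      using k by (intro divide_left_mono) (auto intro!: power_mono)
    thus "real (card ({m. k ^ A dvd m} \<inter> {1..N})) \<le> real N / 2 ^ A"
      using card_multiples_le[of "k ^ A" N] by linarith
  qed
  also have "\<dots> = real (Y - 1) * (real N / 2 ^ A)" by simp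
  also have "\<dots> \<le> real Y * (real N / 2 ^ A)" by (intro mult_right_mono) auto
  finally show "real (card ({m. \<exists>k\<in>{2..Y}. k ^ A dvd m} \<inter> {1..N})) \<le> real Y / 2 ^ A * real N" by simp
qed

text \<open>Quotient and remainder modulo \<open>P\<close> place each such integer in one of
  \<open>N div P + 1\<close> blocks, with a remainder prime to \<open>P\<close>. As
  \<open>P > 1\<close>, the remainder is nonzero and hence a totative.\<close>

lemma card_coprime_le:
  assumes "P > 1"
  shows "card ({m. coprime m P} \<inter> {1..N}) \<le> (N div P + 1) * totient P"
proof -
  define S where "S = {m. coprime m P} \<inter> {1..N}"
  have "inj_on (\<lambda>m. (m div P, m mod P)) S"
    by (rule inj_onI) (metis div_mult_mod_eq prod.inject)
  moreover have "(\<lambda>m. (m div P, m mod P)) ` S \<subseteq> {..N div P} \<times> totatives P"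
  proof (rule image_subsetI)
    fix m assume m: "m \<in> S"
    have cop: "coprime (m mod P) P" using m assms by (simp add: S_def)
    hence "m mod P \<noteq> 0" using assms by (intro notI) auto
    moreover have "m mod P \<le> P" using assms by (simp add: less_imp_le)
    ultimately show "(m div P, m mod P) \<in> {..N div P} \<times> totatives P"
      using m cop by (auto simp: S_def totatives_def div_le_mono)
  qed
  ultimately have "card S \<le> card ({..N div P} \<times> totatives P)"
    by (intro card_inj_on_le) auto
  thus ?thesis by (simp add: S_def card_cartesian_product totient_def)
qed

text \<open>The density of the integers coprime to \<open>P = \<Prod>Q\<close> is \<open>\<phi>(P)/P = \<Prod>(1 - 1/q) \<le> exp (- \<Sum> 1/q)\<close>.\<close>
lemma density_zero_avoiding_primes:
  fixes R :: "nat \<Rightarrow> bool"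
  assumes unb: "\<And>B. \<exists>N. (\<Sum>q\<in>primes_le N. if R q then 1 / real q else 0) > B" and e: "e > 0"
  shows "density_le {m. \<not> (\<exists>q. prime q \<and> R q \<and> q dvd m)} e"
proof -
  \<comment> \<open>Positivity of the sum keeps \<open>Q\<close> nonempty, so \<open>P > 1\<close>;
    the logarithmic bound makes the exponential below at most e/2.\<close>
  obtain M where M: "(\<Sum>q\<in>primes_le M. if R q then 1 / real q else 0) > max 0 (- ln (e / 2))"
    using unb by blast
  define Q where "Q = {q\<in>primes_le M. R q}"
  have Q: "finite Q" "\<And>q. q \<in> Q \<Longrightarrow> prime q" by (auto simp: Q_def primes_le_def[of M])
  have sumQ: "(\<Sum>q\<in>Q. 1 / real q) > max 0 (- ln (e / 2))"
    using M unfolding Q_def by (subst sum.inter_filter) auto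
  define P where "P = \<Prod>Q"
  have "Q \<noteq> {}" using sumQ by auto
  then obtain q0 where q0: "q0 \<in> Q" by blast
  have P0: "P > 0" using Q by (auto simp: P_def intro!: prod_pos prime_gt_0_nat)
  have "q0 dvd P" unfolding P_def using q0 Q by (intro dvd_prodI) auto
  hence P1: "P > 1" using P0 dvd_imp_le[of q0 P] prime_gt_1_nat[OF Q(2)[OF q0]] by linarith
  have "totient P = (\<Prod>q\<in>Q. totient q)"
    unfolding P_def using Q(2) by (intro totient_prod_coprime) (auto simp: pairwise_def intro: primes_coprime)
  also have "\<dots> = (\<Prod>q\<in>Q. q - 1)" using Q(2) by (intro prod.cong refl totient_prime) auto
  finally have "real (totient P) = (\<Prod>q\<in>Q. real (q - 1))" by simp
  also have "\<dots> \<le> (\<Prod>q\<in>Q. real q * exp (- (1 / real q)))"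
  proof (rule prod_mono, rule conjI)
    fix q assume "q \<in> Q"
    hence q: "q \<ge> 1" using Q(2) prime_ge_1_nat by blast
    have "real (q - 1) = real q * (1 - 1 / real q)" using q by (simp add: field_simps of_nat_diff)
    also have "\<dots> \<le> real q * exp (- (1 / real q))"
      using exp_ge_add_one_self[of "- (1 / real q)"] by (intro mult_left_mono) auto
    finally show "real (q - 1) \<le> real q * exp (- (1 / real q))" .
  qed auto
  also have "\<dots> = real P * exp (- (\<Sum>q\<in>Q. 1 / real q))"
    by (simp only: prod.distrib P_def of_nat_prod exp_sum[OF Q(1), symmetric] sum_negf)
  also have "\<dots> \<le> real P * (e / 2)"
  proof (rule mult_left_mono)
    have "exp (- (\<Sum>q\<in>Q. 1 / real q)) \<le> exp (ln (e / 2))" using sumQ by simp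
    thus "exp (- (\<Sum>q\<in>Q. 1 / real q)) \<le> e / 2" using e by simp
  qed auto
  finally have tot: "real (totient P) \<le> real P * (e / 2)" .
  have "density_le {m. coprime m P} e"
    unfolding density_le_def
  \<comment> \<open>From this threshold on, the last incomplete block, of size at most
    \<open>P\<close>, is absorbed by the other half of \<open>e\<close>.\<close>
  proof (rule eventually_mono[OF eventually_ge_at_top[of "nat \<lceil>2 * real P / e\<rceil>"]])
    fix N assume "N \<ge> nat \<lceil>2 * real P / e\<rceil>"
    hence "2 * real P / e \<le> real N" by linarith
    hence N: "real P \<le> e / 2 * real N" using e by (simp add: field_simps)
    have "real (card ({m. coprime m P} \<inter> {1..N})) \<le> real ((N div P + 1) * totient P)"
      using card_coprime_le[OF P1, of N] of_nat_le_iff by blast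
    also have "\<dots> = real (N div P) * real (totient P) + real (totient P)"
      by (simp add: algebra_simps)
    also have "\<dots> \<le> real N / real P * (real P * (e / 2)) + real P"
      using tot of_nat_div_le_of_nat[of N P, where 'a = real] totient_le[of P]
      by (intro add_mono mult_mono) auto
    also have "\<dots> = e / 2 * real N + real P" using P0 by simp
    finally show "real (card ({m. coprime m P} \<inter> {1..N})) \<le> e * real N" using N by simp
  qed
  moreover have "{m. \<not> (\<exists>q. prime q \<and> R q \<and> q dvd m)} \<subseteq> {m. coprime m P}"
  proof safe
    fix m assume m: "\<not> (\<exists>q. prime q \<and> R q \<and> q dvd m)"
    have "coprime m q" if "q \<in> Q" for q
      using m that Q(2)[OF that] prime_imp_coprime[of q m] by (auto simp: Q_def coprime_commute)
    thus "coprime m P" unfolding P_def by (intro prod_coprime_right) auto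
  qed
  ultimately show ?thesis by (rule density_le_subset)
qed

text \<open>Three exceptional sets get e/3 each: a large square divisor, a high power of a small
  number, and the absence of a suitable prime q for some prime p up to \<open>Y\<close>. Outside
  them \<open>d_fun_eq_f_fun\<close> applies.\<close>

lemma density_zero_d_fun_neq_f_fun:
  assumes "e > 0"
  shows "density_le {m. d_fun m \<noteq> f_fun m} e"
proof -
  obtain Y :: nat where "real Y > 3 / e" using reals_Archimedean2 by blast
  moreover have "3 / e > 0" using assms by simp
  ultimately have Y: "Y > 0" by (cases Y) auto
  have Y': "1 / real Y \<le> e / 3" using \<open>real Y > 3 / e\<close> assms Y by (simp add: field_simps)
  obtain A :: nat where "real A > real Y / (e / 3)" using reals_Archimedean2 by blast
  moreover have "real A < 2 ^ A" using of_nat_less_two_power by blast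
  ultimately have "real Y / (e / 3) < 2 ^ A" by linarith
  hence A: "real Y / 2 ^ A \<le> e / 3" using assms by (simp add: field_simps)
  \<comment> \<open>The part \<open>2 * A\<close> covers twice any multiplicity below
    \<open>A\<close>; the added 3 meets the requirement of
    \<open>chars_separate_prime_power\<close>.\<close>
  define n where "n = (\<lambda>p::nat. p ^ (2 * A + 3))"
  define C where "C = (\<lambda>p. {m. \<not> (\<exists>q. prime q \<and> [q = 1] (mod n p) \<and> q dvd m)})"
  have "density_le (\<Union>p\<in>primes_le Y. C p) (e / 3)"
  proof (rule density_zero_UN)
    fix p and e :: real assume p: "p \<in> primes_le Y" and e: "e > 0"
    hence "prime p" by (simp add: primes_le_def)
    hence "n p > 0" "chars_separate (n p)"
      unfolding n_def by (auto intro!: chars_separate_prime_power prime_gt_0_nat)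
    from primes_cong_1_reciprocals_unbounded[OF this] show "density_le (C p) e"
      unfolding C_def using e by (intro density_zero_avoiding_primes)
  qed (use assms in auto)
  hence "density_le (({m. \<exists>k>Y. k\<^sup>2 dvd m} \<union> {m. \<exists>k\<in>{2..Y}. k ^ A dvd m}) \<union> (\<Union>p\<in>primes_le Y. C p))
           ((1 / real Y + real Y / 2 ^ A) + e / 3)"
    by (intro density_le_Un density_le_large_square_divisor density_le_small_power_divisor Y)
  moreover have "1 / real Y + real Y / 2 ^ A + e / 3 \<le> e" using Y' A by linarith
  ultimately have "density_le (({m. \<exists>k>Y. k\<^sup>2 dvd m} \<union> {m. \<exists>k\<in>{2..Y}. k ^ A dvd m}) \<union> (\<Union>p\<in>primes_le Y. C p)) e"
    by (rule density_le_mono)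
  moreover have "{m. d_fun m \<noteq> f_fun m} \<subseteq>
      ({m. \<exists>k>Y. k\<^sup>2 dvd m} \<union> {m. \<exists>k\<in>{2..Y}. k ^ A dvd m}) \<union> (\<Union>p\<in>primes_le Y. C p)"
  proof
    fix m assume "m \<in> {m. d_fun m \<noteq> f_fun m}"
    hence neq: "d_fun m \<noteq> f_fun m" by simp
    show "m \<in> ({m. \<exists>k>Y. k\<^sup>2 dvd m} \<union> {m. \<exists>k\<in>{2..Y}. k ^ A dvd m}) \<union> (\<Union>p\<in>primes_le Y. C p)"
    proof (rule ccontr)
      assume out: "\<not> ?thesis"
      have "m > 0"
      proof (rule ccontr)
        assume "\<not> m > 0"
        \<comment> \<open>The integer 0 lies in the first exceptional set, being divisible by every
          square.\<close>
        hence "(Suc Y)\<^sup>2 dvd m" by simp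
        thus False using out by blast
      qed
      moreover have "\<exists>q. prime q \<and> q dvd m \<and> [q = 1] (mod p ^ (2 * multiplicity p m))"
        if p: "prime p" "p\<^sup>2 dvd m" for p
      proof -
        have pY: "p \<le> Y" using out p by (auto simp: not_less)
        hence "p \<in> primes_le Y" using p by (simp add: primes_le_def)
        then obtain q where q: "prime q" "[q = 1] (mod n p)" "q dvd m"
          using out by (auto simp: C_def)
        have "\<not> p ^ A dvd m" using out pY prime_ge_2_nat[OF p(1)] by auto
        hence "multiplicity p m < A" using multiplicity_dvd'[of A p m] not_less by blast
        hence "p ^ (2 * multiplicity p m) dvd n p" unfolding n_def by (intro le_imp_power_dvd) auto
        thus ?thesis using q cong_dvd_modulus_nat by blast
      qed
      ultimately show False using d_fun_eq_f_fun neq by blast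
    qed
  qed
  ultimately show ?thesis by (rule density_le_subset)
qed

theorem theorem1p2:
  shows "(\<lambda>N. real (card {m \<in> {1..N}. d_fun m = f_fun m}) / real N) \<longlonglongrightarrow> 1"
proof (rule LIMSEQ_I, goal_cases)
  case (1 e)
  define S where "S = {m. d_fun m \<noteq> f_fun m}"
  \<comment> \<open>Half of \<open>e\<close>, because the density bound is not strict while the
    limit requires a strict inequality.\<close>
  have "density_le S (e / 2)" unfolding S_def using 1 by (intro density_zero_d_fun_neq_f_fun) auto
  hence "\<forall>\<^sub>F N in sequentially. norm (real (card {m \<in> {1..N}. d_fun m = f_fun m}) / real N - 1) < e"
    unfolding density_le_def using eventually_gt_at_top[of 0]
  proof eventually_elim
    case (elim N)
    have "{1..N} = {m \<in> {1..N}. d_fun m = f_fun m} \<union> S \<inter> {1..N}" by (auto simp: S_def)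
    moreover have "card ({m \<in> {1..N}. d_fun m = f_fun m} \<union> S \<inter> {1..N}) =
        card {m \<in> {1..N}. d_fun m = f_fun m} + card (S \<inter> {1..N})"
      by (rule card_Un_disjoint) (auto simp: S_def)
    ultimately have "N = card {m \<in> {1..N}. d_fun m = f_fun m} + card (S \<inter> {1..N})"
      by (metis card_atLeastAtMost diff_Suc_1)
    hence "real N = real (card {m \<in> {1..N}. d_fun m = f_fun m}) + real (card (S \<inter> {1..N}))"
      by linarith
    hence "real (card {m \<in> {1..N}. d_fun m = f_fun m}) / real N - 1 = - (real (card (S \<inter> {1..N})) / real N)"
      using elim by (simp add: field_simps)
    moreover have "real (card (S \<inter> {1..N})) / real N \<le> e / 2" using elim by (simp add: field_simps)
    moreover have "real (card (S \<inter> {1..N})) / real N \<ge> 0" by simp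
    ultimately show ?case using 1 unfolding real_norm_def by linarith
  qed
  thus ?case by (simp add: eventually_sequentially)
qed

end
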